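(* Let $\pi\in S_4$ and let $p=(\pi,R)$ with $R=([4]\times\{0\})\cup([4]\times\{4\})$ (exactly the boxes of the bottom and top rows shaded). Let $n\ge4$. \begin{enumerate} \item If the letters $2$ and $3$ are not in adjacent positions of $\pi$, then \[ s_n^+(p)=(n-2)!\sum_{k=2}^{n-2}\sum_{\ell=k+1}^{n-1}\left(1-\binom{n-\ell+k-1}{k-1}^{-1}\right). \] \item If the letters $2$ and $3$ are in adjacent positions of $\pi$, then \[ s_n^+(p)=(n-2)!\sum_{k=3}^{n-1}(n-k)\left(1-\frac1{(k-1)!}\right). \] \end{enumerate} In both cases, \[ \lim_{n\to\infty}\frac{s_n^+(p)}{n!}=\frac12. \]
   Context: For $n\ge1$, $S_n$ is the set of permutations of $\{1,\dots,n\}$ in one-line notation $\tau=\tau_1\cdots\tau_n$. For an integer $k\ge0$ write $[k]=\{0,1,\dots,k\}$. A mesh pattern of length $k$ is a pair $(\pi,R)$ with $\pi\in S_k$ and $R\subseteq[k]\times[k]$; the elements $(x,y)\in R$ are the shaded boxes (box $(x,y)$ is the unit square with south-west corner $(x,y)$ in the plot of the points $(i,\pi_i)$). An occurrence of $(\pi,R)$ in $\tau\in S_n$ is a choice of positions $i_1<\dots<i_k$ such that $\tau_{i_a}<\tau_{i_b}$ iff $\pi_a<\pi_b$ for all $a,b$, and such that for every $(x,y)\in R$ there is no index $m$ with $i_x<m<i_{x+1}$ and $v_y<\tau_m<v_{y+1}$, where $i_0=0$, $i_{k+1}=n+1$, $v_0=0$, $v_{k+1}=n+1$, and for $1\le y\le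 k$, $v_y$ is the $y$-th smallest of the values $\tau_{i_1},\dots,\tau_{i_k}$. A permutation contains a mesh pattern if it has at least one occurrence of it, and $s_n^+(p)$ denotes the number of permutations in $S_n$ containing $p$. *)

theory Defs
  imports Complex_Main "HOL-Combinatorics.Permutations"
begin

text \<open>
  A permutation \<open>\<tau>\<^sub>1\<dots>\<tau>\<^sub>n\<close> in one-line notation is a function with
  \<open>\<tau> permutes {1..n}\<close>; its value at position \<open>j\<close> is \<open>\<tau> j\<close>.  A mesh pattern of length \<open>k\<close>
  is a pair \<open>(\<pi>, R)\<close> with \<open>\<pi> permutes {1..k}\<close> and \<open>R \<subseteq> {0..k} \<times> {0..k}\<close>; the length is
  not determined by the pair, so it is passed as a separate argument.
\<close>

type_synonym mesh_pattern = "(nat \<Rightarrow> nat) \<times> (nat \<times> nat) set"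

text \<open>
  Only \<open>i 1, \<dots>, i k\<close> are the chosen positions; \<open>mesh_pos\<close> and \<open>mesh_val\<close> add the boundary
  conventions \<open>i\<^sub>0 = v\<^sub>0 = 0\<close> and \<open>i\<^bsub>k+1\<^esub> = v\<^bsub>k+1\<^esub> = n + 1\<close>.
\<close>

definition mesh_pos :: "nat \<Rightarrow> nat \<Rightarrow> (nat \<Rightarrow> nat) \<Rightarrow> nat \<Rightarrow> nat" where
  "mesh_pos n k i x = (if x = 0 then 0 else if x = k + 1 then n + 1 else i x)"

text \<open>The \<open>y\<close>-th smallest chosen value has index \<open>y - 1\<close> because list indices start at 0.\<close>

definition mesh_val :: "nat \<Rightarrow> nat \<Rightarrow> (nat \<Rightarrow> nat) \<Rightarrow> (nat \<Rightarrow> nat) \<Rightarrow> nat \<Rightarrow> nat" where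
  "mesh_val n k \<tau> i y =
     (if y = 0 then 0 else if y = k + 1 then n + 1
      else sorted_list_of_set ((\<lambda>a. \<tau> (i a)) ` {1..k}) ! (y - 1))"

definition mesh_occurrence ::
  "nat \<Rightarrow> mesh_pattern \<Rightarrow> nat \<Rightarrow> (nat \<Rightarrow> nat) \<Rightarrow> (nat \<Rightarrow> nat) \<Rightarrow> bool" where
  "mesh_occurrence k p n \<tau> i \<longleftrightarrow>
     i ` {1..k} \<subseteq> {1..n} \<and> strict_mono_on {1..k} i \<and>
     (\<forall>a\<in>{1..k}. \<forall>b\<in>{1..k}. \<tau> (i a) < \<tau> (i b) \<longleftrightarrow> fst p a < fst p b) \<and>
     (\<forall>(x, y)\<in>snd p. \<not> (\<exists>m\<in>{1..n}.
        mesh_pos n k i x < m \<and> m < mesh_pos n k i (x + 1) \<and>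
        mesh_val n k \<tau> i y < \<tau> m \<and> \<tau> m < mesh_val n k \<tau> i (y + 1)))"

definition contains_mesh :: "nat \<Rightarrow> mesh_pattern \<Rightarrow> nat \<Rightarrow> (nat \<Rightarrow> nat) \<Rightarrow> bool" where
  "contains_mesh k p n \<tau> \<longleftrightarrow> (\<exists>i. mesh_occurrence k p n \<tau> i)"

definition s_plus :: "nat \<Rightarrow> mesh_pattern \<Rightarrow> nat \<Rightarrow> nat" where
  "s_plus k p n = card {\<tau>. \<tau> permutes {1..n} \<and> contains_mesh k p n \<tau>}"

definition adjacent_letters :: "nat \<Rightarrow> (nat \<Rightarrow> nat) \<Rightarrow> nat \<Rightarrow> nat \<Rightarrow> bool" where
  "adjacent_letters k \<pi> a b \<longleftrightarrow> (\<exists>j\<in>{1..<k}. {\<pi> j, \<pi> (j + 1)} = {a, b})"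

end

theory Submission
  imports Defs
begin

text \<open>
  The two shaded rows force the letters 1 and 4 of an occurrence to be the values 1 and \<open>n\<close>.
  Their positions \<open>k < l\<close> cut the remaining positions into three gaps, and an occurrence is then
  given by a position \<open>x\<close> for the letter 2 and a position \<open>y\<close> for the letter 3 in prescribed gaps
  with \<open>\<tau> x < \<tau> y\<close>.  If the gaps differ, with sizes \<open>a\<close> and \<open>b\<close>, the pattern is avoided iff the
  first gap carries the \<open>a\<close> largest of the \<open>a + b\<close> values, which has probability
  \<open>1 / ((a + b) choose a)\<close>; if they coincide, it is avoided iff the gap is monotone, which has
  probability \<open>1 / fact a\<close>.  All assignments of sizes to the three gaps being equally frequent, the
  sum over \<open>k < l\<close> depends only on whether the gaps coincide.  For fixed \<open>l\<close> the
  avoidance probabilities add up to at most 4, so they are negligible against the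
  \<open>n * (n - 1) / 2\<close> pairs \<open>(k, l)\<close>.
\<close>

section \<open>Ranks, top subsets and sorting permutations\<close>

text \<open>Rank 0 belongs to the maximum, so for an injective \<open>f\<close> the \<open>s\<close>
  largest elements are exactly those of rank below \<open>s\<close>.\<close>

definition rank_desc :: "('a \<Rightarrow> 'b::linorder) \<Rightarrow> 'a set \<Rightarrow> 'a \<Rightarrow> nat" where
  "rank_desc f A x = card {y \<in> A. f x < f y}"

lemma rank_desc_less:
  assumes "finite A" "y \<in> A" "f x < f y"
  shows "rank_desc f A y < rank_desc f A x"
  unfolding rank_desc_def
proof (rule psubset_card_mono)
  show "{z \<in> A. f y < f z} \<subset> {z \<in> A. f x < f z}"
    using assms by (auto intro: less_trans)
qed (use assms in auto)

lemma rank_desc_less_iff: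
  assumes "finite A" "x \<in> A" "y \<in> A" "inj_on f A"
  shows "rank_desc f A y < rank_desc f A x \<longleftrightarrow> f x < f y"
  using assms by (metis inj_onD less_asym linorder_less_linear rank_desc_less order_less_irrefl)

lemma bij_betw_rank_desc:
  assumes "finite A" "inj_on f A"
  shows "bij_betw (rank_desc f A) A {..<card A}"
proof -
  have inj: "inj_on (rank_desc f A) A"
  proof (rule inj_onI)
    fix x y
    assume xy: "x \<in> A" "y \<in> A" and eq: "rank_desc f A x = rank_desc f A y"
    then have "\<not> f x < f y" "\<not> f y < f x"
      using rank_desc_less[OF assms(1), of y f x] rank_desc_less[OF assms(1), of x f y] by auto
    then have "f x = f y"
      by simp
    with xy assms(2) show "x = y"
      by (simp add: inj_onD)
  qed
  have "rank_desc f A x < card A" if "x \<in> A" for x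
    unfolding rank_desc_def using that assms by (intro psubset_card_mono) auto
  then have "rank_desc f A ` A \<subseteq> {..<card A}"
    by auto
  then have "rank_desc f A ` A = {..<card A}"
    using inj by (intro card_subset_eq) (auto simp: card_image)
  with inj show ?thesis
    by (simp add: bij_betw_def)
qed

text \<open>The elements of rank below \<open>s\<close> form such a set. Two such sets are nested,
  since otherwise an element of each outside the other would have to exceed its counterpart; having
  equal size, they coincide.\<close>

lemma ex1_top_subset:
  fixes f :: "'a \<Rightarrow> 'b::linorder"
  assumes "finite C" "inj_on f C" "s \<le> card C"
  shows "\<exists>!D. D \<in> {D. D \<subseteq> C \<and> card D = s} \<and> (\<forall>d\<in>D. \<forall>e\<in>C - D. f e < f d)"
proof (rule ex_ex1I)
  let ?D = "{x \<in> C. rank_desc f C x < s}"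
  have "rank_desc f C ` ?D = rank_desc f C ` C \<inter> {..<s}"
    by auto
  also have "\<dots> = {..<s}"
    using bij_betw_imp_surj_on[OF bij_betw_rank_desc[OF assms(1,2)]] assms(3) by auto
  finally have "rank_desc f C ` ?D = {..<s}" .
  moreover have "inj_on (rank_desc f C) ?D"
    using bij_betw_rank_desc[OF assms(1,2)] unfolding bij_betw_def
    by (auto intro: inj_on_subset)
  ultimately have "card ?D = s"
    using card_image by fastforce
  moreover have "f e < f d" if "d \<in> ?D" "e \<in> C - ?D" for d e
    using that rank_desc_less_iff[OF assms(1) _ _ assms(2), of e d] by auto
  ultimately show "\<exists>D. D \<in> {D. D \<subseteq> C \<and> card D = s} \<and> (\<forall>d\<in>D. \<forall>e\<in>C - D. f e < f d)"
    by (intro exI[of _ ?D]) blast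
next
  fix D D'
  assume D: "D \<in> {D. D \<subseteq> C \<and> card D = s} \<and> (\<forall>d\<in>D. \<forall>e\<in>C - D. f e < f d)"
    and D': "D' \<in> {D. D \<subseteq> C \<and> card D = s} \<and> (\<forall>d\<in>D'. \<forall>e\<in>C - D'. f e < f d)"
  have fin: "finite D" "finite D'"
    using D D' assms(1) by (auto intro: finite_subset)
  have "D \<subseteq> D' \<or> D' \<subseteq> D"
  proof (rule ccontr)
    assume "\<not> (D \<subseteq> D' \<or> D' \<subseteq> D)"
    then obtain d d' where "d \<in> D" "d \<notin> D'" "d' \<in> D'" "d' \<notin> D"
      by blast
    then have "d' \<in> C - D" "d \<in> C - D'"
      using D D' by auto
    then have "f d' < f d" "f d < f d'"
      using bspec[OF bspec[OF conjunct2[OF D] \<open>d \<in> D\<close>]]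
        bspec[OF bspec[OF conjunct2[OF D'] \<open>d' \<in> D'\<close>]] by simp_all
    then show False by simp
  qed
  moreover have "card D = card D'"
    using D D' by simp
  ultimately show "D = D'"
    using card_subset_eq[OF fin(2), of D] card_subset_eq[OF fin(1), of D'] by metis
qed

text \<open>Matching ranks under \<open>v\<close> with ranks under \<open>f\<close> is the only
  order-preserving rearrangement. The free key \<open>v\<close> covers increasing and decreasing
  order at once.\<close>

lemma ex1_sorting_permutation:
  fixes f :: "'a \<Rightarrow> 'b::linorder" and v :: "'a \<Rightarrow> 'c::linorder"
  assumes "finite A" "inj_on f A" "inj_on v A"
  shows "\<exists>!\<sigma>. \<sigma> \<in> {\<sigma>. \<sigma> permutes A} \<and> (\<forall>a\<in>A. \<forall>b\<in>A. v a < v b \<longrightarrow> f (\<sigma> a) < f (\<sigma> b))"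
proof (rule ex_ex1I)
  note bf = bij_betw_rank_desc[OF assms(1,2)]
  note bv = bij_betw_rank_desc[OF assms(1,3)]
  let ?g = "\<lambda>a. inv_into A (rank_desc f A) (rank_desc v A a)"
  let ?\<sigma> = "\<lambda>a. if a \<in> A then ?g a else a"
  have "bij_betw ?g A A"
    using bij_betw_trans[OF bv bij_betw_inv_into[OF bf]] by (simp add: comp_def)
  then have \<sigma>: "?\<sigma> permutes A"
    by (intro bij_imp_permutes) (auto cong: bij_betw_cong)
  have rk: "rank_desc f A (?\<sigma> a) = rank_desc v A a" if "a \<in> A" for a
    using that bij_betw_inv_into_right[OF bf] bij_betwE[OF bv] by simp
  have "f (?\<sigma> a) < f (?\<sigma> b)" if ab: "a \<in> A" "b \<in> A" "v a < v b" for a b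
  proof -
    have "rank_desc f A (?\<sigma> b) < rank_desc f A (?\<sigma> a)"
      using rank_desc_less[OF assms(1) ab(2,3)] unfolding rk[OF ab(1)] rk[OF ab(2)] .
    moreover have "?\<sigma> a \<in> A" "?\<sigma> b \<in> A"
      using ab(1,2) permutes_in_image[OF \<sigma>] by blast+
    ultimately show ?thesis
      using rank_desc_less_iff[OF assms(1) _ _ assms(2)] by blast
  qed
  with \<sigma> show "\<exists>\<sigma>. \<sigma> \<in> {\<sigma>. \<sigma> permutes A} \<and> (\<forall>a\<in>A. \<forall>b\<in>A. v a < v b \<longrightarrow> f (\<sigma> a) < f (\<sigma> b))"
    by (intro exI[of _ ?\<sigma>]) blast
next
  \<comment> \<open>Uniqueness: a sorting permutation is forced to carry rank under \<open>v\<close>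
    to rank under \<open>f\<close>, and ranks identify elements.\<close>
  have rk: "rank_desc f A (\<sigma> a) = rank_desc v A a"
    if \<sigma>: "\<sigma> permutes A" and m: "\<forall>a\<in>A. \<forall>b\<in>A. v a < v b \<longrightarrow> f (\<sigma> a) < f (\<sigma> b)"
      and a: "a \<in> A" for \<sigma> a
  proof -
    \<comment> \<open>Linearity of both orders and injectivity of \<open>v\<close> upgrade the
      one-way monotonicity to an equivalence.\<close>
    have iff: "f (\<sigma> a) < f (\<sigma> b) \<longleftrightarrow> v a < v b" if "b \<in> A" for b
      using m a that assms(3) by (metis inj_onD less_asym linorder_less_linear order_less_irrefl)
    have "{y \<in> A. f (\<sigma> a) < f y} = \<sigma> ` {b \<in> A. v a < v b}"
    proof -
      have "y \<in> \<sigma> ` {b \<in> A. v a < v b}" if "y \<in> A" "f (\<sigma> a) < f y" for y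
        using that iff permutes_image[OF \<sigma>] by (smt (verit) imageE image_eqI mem_Collect_eq)
      then show ?thesis
        using iff permutes_in_image[OF \<sigma>] by auto
    qed
    then show ?thesis
      unfolding rank_desc_def by (simp add: card_image permutes_inj_on[OF \<sigma>])
  qed
  fix \<sigma> \<sigma>'
  assume 1: "\<sigma> \<in> {\<sigma>. \<sigma> permutes A} \<and> (\<forall>a\<in>A. \<forall>b\<in>A. v a < v b \<longrightarrow> f (\<sigma> a) < f (\<sigma> b))"
    and 2: "\<sigma>' \<in> {\<sigma>. \<sigma> permutes A} \<and> (\<forall>a\<in>A. \<forall>b\<in>A. v a < v b \<longrightarrow> f (\<sigma>' a) < f (\<sigma>' b))"
  show "\<sigma> = \<sigma>'"
  proof
    fix a
    show "\<sigma> a = \<sigma>' a"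
    proof (cases "a \<in> A")
      case True
      then have "rank_desc f A (\<sigma> a) = rank_desc f A (\<sigma>' a)"
        using rk[of \<sigma> a] rk[of \<sigma>' a] 1 2 by simp
      moreover have "\<sigma> a \<in> A" "\<sigma>' a \<in> A"
        using True 1 2 by (auto simp: permutes_in_image)
      ultimately show ?thesis
        using bij_betw_rank_desc[OF assms(1,2)] by (auto simp: bij_betw_def dest: inj_onD)
    next
      case False
      then show ?thesis
        using 1 2 by (auto simp: permutes_not_in)
    qed
  qed
qed

section \<open>Counting by equally frequent translates\<close>

text \<open>If exactly one member of a family of properties holds at each point of \<open>T\<close>, and the
  members are translates of one property \<open>P\<close>, then all of them are equally frequent.\<close>

lemma card_eq_card_times_translates:
  assumes fin: "finite T" "finite I"
    and closed: "\<And>\<sigma> \<tau>. \<sigma> permutes C \<Longrightarrow> \<tau> \<in> T \<Longrightarrow> \<tau> \<circ> \<sigma> \<in> T"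
    and ex1: "\<And>\<tau>. \<tau> \<in> T \<Longrightarrow> \<exists>!i. i \<in> I \<and> Q i \<tau>"
    and translate: "\<And>i. i \<in> I \<Longrightarrow> \<exists>\<sigma>. \<sigma> permutes C \<and> (\<forall>\<tau>\<in>T. Q i \<tau> \<longleftrightarrow> P (\<tau> \<circ> \<sigma>))"
  shows "card T = card I * card {\<tau> \<in> T. P \<tau>}"
proof -
  have "T = (\<Union>i\<in>I. {\<tau> \<in> T. Q i \<tau>})"
    using ex1 by blast
  then have "card T = card (\<Union>i\<in>I. {\<tau> \<in> T. Q i \<tau>})"
    by simp
  also have "\<dots> = (\<Sum>i\<in>I. card {\<tau> \<in> T. Q i \<tau>})"
    using fin ex1 by (intro card_UN_disjoint) auto
  also have "\<dots> = (\<Sum>i\<in>I. card {\<tau> \<in> T. P \<tau>})"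
  proof (rule sum.cong[OF refl])
    fix i
    assume "i \<in> I"
    then obtain \<sigma> where \<sigma>: "\<sigma> permutes C" and Q: "\<And>\<tau>. \<tau> \<in> T \<Longrightarrow> Q i \<tau> \<longleftrightarrow> P (\<tau> \<circ> \<sigma>)"
      using translate by blast
    have inv: "inv \<sigma> permutes C"
      using \<sigma> by (rule permutes_inv)
    \<comment> \<open>Rearranging the arguments by \<open>\<sigma>\<close> is undone by
      \<open>inv \<sigma>\<close>, and \<open>T\<close> is closed under both.\<close>
    have "bij_betw (\<lambda>\<tau>. \<tau> \<circ> \<sigma>) {\<tau> \<in> T. Q i \<tau>} {\<tau> \<in> T. P \<tau>}"
    proof (rule bij_betw_byWitness[where f' = "\<lambda>\<tau>. \<tau> \<circ> inv \<sigma>"])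
      have *: "\<tau> \<circ> inv \<sigma> \<circ> \<sigma> = \<tau>" "\<tau> \<circ> \<sigma> \<circ> inv \<sigma> = \<tau>" for \<tau> :: "'a \<Rightarrow> 'b"
        using permutes_inv_o[OF \<sigma>] by (simp_all add: o_assoc[symmetric])
      show "\<forall>\<tau>\<in>{\<tau> \<in> T. Q i \<tau>}. \<tau> \<circ> \<sigma> \<circ> inv \<sigma> = \<tau>"
        "\<forall>\<tau>\<in>{\<tau> \<in> T. P \<tau>}. \<tau> \<circ> inv \<sigma> \<circ> \<sigma> = \<tau>"
        by (simp_all add: *)
      show "(\<lambda>\<tau>. \<tau> \<circ> \<sigma>) ` {\<tau> \<in> T. Q i \<tau>} \<subseteq> {\<tau> \<in> T. P \<tau>}"
        using closed[OF \<sigma>] Q by auto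
      show "(\<lambda>\<tau>. \<tau> \<circ> inv \<sigma>) ` {\<tau> \<in> T. P \<tau>} \<subseteq> {\<tau> \<in> T. Q i \<tau>}"
        using closed[OF inv] Q * by auto
    qed
    then show "card {\<tau> \<in> T. Q i \<tau>} = card {\<tau> \<in> T. P \<tau>}"
      by (rule bij_betw_same_card)
  qed
  finally show ?thesis
    by simp
qed

text \<open>The complements of \<open>A\<close> and \<open>D\<close> in \<open>C\<close> also have
  equal size, so a bijection between the sets and one between the complements can be glued
  together.\<close>

lemma ex_permutes_image_eq:
  assumes "finite C" "A \<subseteq> C" "D \<subseteq> C" "card A = card D"
  shows "\<exists>\<sigma>. \<sigma> permutes C \<and> \<sigma> ` A = D"
proof -
  have fin: "finite A" "finite D"
    using assms finite_subset by auto
  obtain f where f: "bij_betw f A D"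
    using assms(4) fin finite_same_card_bij by blast
  have "card (C - A) = card (C - D)"
    using assms fin by (simp add: card_Diff_subset)
  then obtain g where g: "bij_betw g (C - A) (C - D)"
    using assms(1) finite_same_card_bij[of "C - A" "C - D"] by blast
  let ?\<sigma> = "\<lambda>x. if x \<in> A then f x else if x \<in> C then g x else x"
  have "bij_betw ?\<sigma> A D"
    using f by (auto cong: bij_betw_cong)
  moreover have "bij_betw ?\<sigma> (C - A) (C - D)"
    using bij_betw_cong[of "C - A" ?\<sigma> g "C - D"] g by auto
  ultimately have "bij_betw ?\<sigma> (A \<union> (C - A)) (D \<union> (C - D))"
    by (intro bij_betw_combine) auto
  moreover have "A \<union> (C - A) = C" "D \<union> (C - D) = C"
    using assms by auto
  ultimately have "?\<sigma> permutes C"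
    using assms(2) by (intro bij_imp_permutes) auto
  moreover have "?\<sigma> ` A = D"
    using f by (auto simp: bij_betw_def)
  ultimately show ?thesis by blast
qed

text \<open>For each member of \<open>T\<close>, exactly one subset of \<open>A \<union> B\<close>
  of size \<open>card A\<close> carries the largest values, and permuting arguments turns any such
  subset into \<open>A\<close>. The index family therefore has binomial size.\<close>

lemma card_dominating:
  fixes T :: "('a \<Rightarrow> 'b::linorder) set"
  assumes "finite T" "finite A" "finite B" "A \<inter> B = {}"
    and closed: "\<And>\<sigma> \<tau>. \<sigma> permutes A \<union> B \<Longrightarrow> \<tau> \<in> T \<Longrightarrow> \<tau> \<circ> \<sigma> \<in> T"
    and inj: "\<And>\<tau>. \<tau> \<in> T \<Longrightarrow> inj_on \<tau> (A \<union> B)"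
  shows "card T = ((card A + card B) choose card A) * card {\<tau> \<in> T. \<forall>a\<in>A. \<forall>b\<in>B. \<tau> b < \<tau> a}"
proof -
  let ?C = "A \<union> B"
  let ?I = "{D. D \<subseteq> ?C \<and> card D = card A}"
  have fC: "finite ?C" and cC: "card ?C = card A + card B"
    using assms by (auto simp: card_Un_disjoint)
  have "card T = card ?I * card {\<tau> \<in> T. \<forall>a\<in>A. \<forall>b\<in>B. \<tau> b < \<tau> a}"
  proof (rule card_eq_card_times_translates[where C = ?C
        and Q = "\<lambda>D \<tau>. \<forall>d\<in>D. \<forall>e\<in>?C - D. \<tau> e < \<tau> d"])
    show "finite ?I"
      using fC by simp
    show "\<exists>!D. D \<in> ?I \<and> (\<forall>d\<in>D. \<forall>e\<in>?C - D. \<tau> e < \<tau> d)" if "\<tau> \<in> T" for \<tau>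
      using ex1_top_subset[OF fC inj[OF that]] cC by simp
    fix D
    assume "D \<in> ?I"
    then obtain \<sigma> where \<sigma>: "\<sigma> permutes ?C" "\<sigma> ` A = D"
      using ex_permutes_image_eq[OF fC, of A D] by auto
    moreover have "?C - D = \<sigma> ` B"
    proof -
      have "?C - D = \<sigma> ` ?C - \<sigma> ` A"
        using \<sigma> by (simp only: permutes_image)
      also have "\<dots> = \<sigma> ` (?C - A)"
        using permutes_inj[OF \<sigma>(1)] by (simp only: image_set_diff)
      also have "?C - A = B"
        using assms by auto
      finally show ?thesis .
    qed
    ultimately show "\<exists>\<sigma>. \<sigma> permutes ?C \<and>
        (\<forall>\<tau>\<in>T. (\<forall>d\<in>D. \<forall>e\<in>?C - D. \<tau> e < \<tau> d) \<longleftrightarrow> (\<forall>a\<in>A. \<forall>b\<in>B. (\<tau> \<circ> \<sigma>) b < (\<tau> \<circ> \<sigma>) a))"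
      by (intro exI[of _ \<sigma>]) auto
  qed (use assms in auto)
  then show ?thesis
    using fC cC by (simp add: n_subsets)
qed

text \<open>Here the rearrangements of \<open>A\<close> index the family: each member of
  \<open>T\<close> is sorted along \<open>v\<close> by exactly one of them, and each is its own
  translating permutation.\<close>

lemma card_monotone:
  fixes T :: "('a \<Rightarrow> 'b::linorder) set" and v :: "'a \<Rightarrow> 'c::linorder"
  assumes "finite T" "finite A" "inj_on v A"
    and closed: "\<And>\<sigma> \<tau>. \<sigma> permutes A \<Longrightarrow> \<tau> \<in> T \<Longrightarrow> \<tau> \<circ> \<sigma> \<in> T"
    and inj: "\<And>\<tau>. \<tau> \<in> T \<Longrightarrow> inj_on \<tau> A"
  shows "card T = fact (card A) * card {\<tau> \<in> T. \<forall>a\<in>A. \<forall>b\<in>A. v a < v b \<longrightarrow> \<tau> a < \<tau> b}"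
proof -
  let ?I = "{\<sigma>. \<sigma> permutes A}"
  have "card T = card ?I * card {\<tau> \<in> T. \<forall>a\<in>A. \<forall>b\<in>A. v a < v b \<longrightarrow> \<tau> a < \<tau> b}"
  proof (rule card_eq_card_times_translates[where C = A
        and Q = "\<lambda>\<sigma> \<tau>. \<forall>a\<in>A. \<forall>b\<in>A. v a < v b \<longrightarrow> \<tau> (\<sigma> a) < \<tau> (\<sigma> b)"])
    show "finite ?I"
      using assms(2) by (rule finite_permutations)
    show "\<exists>!\<sigma>. \<sigma> \<in> ?I \<and> (\<forall>a\<in>A. \<forall>b\<in>A. v a < v b \<longrightarrow> \<tau> (\<sigma> a) < \<tau> (\<sigma> b))" if "\<tau> \<in> T" for \<tau>
      using ex1_sorting_permutation[OF assms(2) inj[OF that] assms(3)] .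
  qed (use assms in auto)
  then show ?thesis
    using assms(2) by (simp add: card_permutations)
qed

section \<open>Permutations with prescribed positions of the values 1 and \<open>n\<close>\<close>

definition perms_at :: "nat \<Rightarrow> nat \<Rightarrow> nat \<Rightarrow> (nat \<Rightarrow> nat) set" where
  "perms_at n P Q = {\<tau>. \<tau> permutes {1..n} \<and> \<tau> P = 1 \<and> \<tau> Q = n}"

lemma finite_perms_at: "finite (perms_at n P Q)"
  unfolding perms_at_def by (rule finite_subset[OF _ finite_permutations[of "{1..n}"]]) auto

text \<open>Provides the closure condition of the two counting lemmas: rearranging positions other
  than \<open>P\<close> and \<open>Q\<close> does not move the extreme values.\<close>

lemma perms_at_comp:
  assumes "\<sigma> permutes C" "\<tau> \<in> perms_at n P Q" "C \<subseteq> {1..n} - {P, Q}"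
  shows "\<tau> \<circ> \<sigma> \<in> perms_at n P Q"
proof -
  have "\<sigma> permutes {1..n}"
    using assms by (blast intro: permutes_subset)
  moreover have "\<sigma> P = P" "\<sigma> Q = Q"
    using assms by (auto simp: permutes_def)
  ultimately show ?thesis
    using assms(2) by (auto simp: perms_at_def intro: permutes_compose)
qed

text \<open>The set is a coset: composing one fixed member \<open>\<tau>0\<close> after the
  permutations that fix \<open>P\<close> and \<open>Q\<close> yields every member once.\<close>

lemma card_perms_at:
  assumes "P \<in> {1..n}" "Q \<in> {1..n}" "P \<noteq> Q"
  shows "card (perms_at n P Q) = fact (n - 2)"
proof -
  let ?S = "{1..n} - {P, Q}"
  \<comment> \<open>\<open>Q'\<close> is where \<open>Q\<close> lands after swapping
    \<open>P\<close> with 1; a second swap takes it to \<open>n\<close> and leaves 1 alone, because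
    neither \<open>Q'\<close> nor \<open>n\<close> is 1.\<close>
  define Q' where "Q' = transpose P 1 Q"
  define \<tau>0 where "\<tau>0 = transpose Q' n \<circ> transpose P 1"
  have Q': "Q' \<in> {1..n}" "Q' \<noteq> 1" and n: "n \<noteq> 1"
    using assms by (auto simp: Q'_def transpose_def)
  have \<tau>0: "\<tau>0 \<in> perms_at n P Q"
    unfolding perms_at_def \<tau>0_def mem_Collect_eq
    using assms Q' n by (auto simp: Q'_def[unfolded One_nat_def, symmetric] intro!: permutes_compose permutes_swap_id)
  then have perm0: "\<tau>0 permutes {1..n}"
    by (simp add: perms_at_def)
  have "bij_betw (\<lambda>\<sigma>. \<tau>0 \<circ> \<sigma>) {\<sigma>. \<sigma> permutes ?S} (perms_at n P Q)"
  proof (rule bij_betw_byWitness[where f' = "\<lambda>\<tau>. inv \<tau>0 \<circ> \<tau>"])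
    show "\<forall>\<sigma>\<in>{\<sigma>. \<sigma> permutes ?S}. inv \<tau>0 \<circ> (\<tau>0 \<circ> \<sigma>) = \<sigma>"
      "\<forall>\<tau>\<in>perms_at n P Q. \<tau>0 \<circ> (inv \<tau>0 \<circ> \<tau>) = \<tau>"
      using permutes_inv_o[OF perm0] by (simp_all add: o_assoc)
    show "(\<lambda>\<sigma>. \<tau>0 \<circ> \<sigma>) ` {\<sigma>. \<sigma> permutes ?S} \<subseteq> perms_at n P Q"
      using perms_at_comp \<tau>0 by blast
    show "(\<lambda>\<tau>. inv \<tau>0 \<circ> \<tau>) ` perms_at n P Q \<subseteq> {\<sigma>. \<sigma> permutes ?S}"
    proof clarify
      fix \<tau>
      assume \<tau>: "\<tau> \<in> perms_at n P Q"
      then have "inv \<tau>0 \<circ> \<tau> permutes {1..n}"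
        using perm0 by (auto simp: perms_at_def intro: permutes_compose permutes_inv)
      moreover have "(inv \<tau>0 \<circ> \<tau>) P = P" "(inv \<tau>0 \<circ> \<tau>) Q = Q"
        using \<tau> \<tau>0 unfolding perms_at_def comp_apply permutes_inv_eq[OF perm0] by simp_all
      ultimately show "inv \<tau>0 \<circ> \<tau> permutes ?S"
        by (elim permutes_superset) blast
    qed
  qed
  then have "card (perms_at n P Q) = card {\<sigma>. \<sigma> permutes ?S}"
    by (simp add: bij_betw_same_card)
  also have "\<dots> = fact (card ?S)"
    by (intro card_permutations) auto
  also have "card ?S = n - 2"
    using assms by (auto simp: card_Diff_subset)
  finally show ?thesis .
qed

section \<open>Occurrences of the mesh pattern\<close>

text \<open>Listed by letter instead of by position, the chosen values are already sorted. Only the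
  smallest and the largest are recorded, as they bound the shaded rows.\<close>

lemma mesh_val_of_chain:
  fixes z :: "nat \<Rightarrow> nat"
  assumes "\<pi> permutes {1..4}" and z: "\<And>a. a \<in> {1..4} \<Longrightarrow> z (\<pi> a) = i a"
    and less: "\<tau> (z 1) < \<tau> (z 2)" "\<tau> (z 2) < \<tau> (z 3)" "\<tau> (z 3) < \<tau> (z 4)"
  shows "mesh_val n 4 \<tau> i 1 = \<tau> (z 1)" "mesh_val n 4 \<tau> i 4 = \<tau> (z 4)"
proof -
  have "(\<lambda>a. \<tau> (i a)) ` {1..4} = (\<lambda>a. \<tau> (z a)) ` (\<pi> ` {1..4})"
    using z by (force simp: image_image)
  also have "\<pi> ` {1..4} = {1, 2, 3, 4}"
    using permutes_image[OF assms(1)] by auto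
  finally have "sorted_list_of_set ((\<lambda>a. \<tau> (i a)) ` {1..4}) = [\<tau> (z 1), \<tau> (z 2), \<tau> (z 3), \<tau> (z 4)]"
    using less by simp
  then show "mesh_val n 4 \<tau> i 1 = \<tau> (z 1)" "mesh_val n 4 \<tau> i 4 = \<tau> (z 4)"
    by (simp_all add: mesh_val_def)
qed

text \<open>The shaded rows run through all five columns, so an unchosen position lies in a shaded
  box as soon as its value falls into one of these rows. This supplies the column.\<close>

lemma ex_mesh_column:
  assumes "m \<in> {1..n}" "m \<notin> i ` {1..4}"
  shows "\<exists>x\<in>{0..4}. mesh_pos n 4 i x < m \<and> m < mesh_pos n 4 i (x + 1)"
proof -
  have "m \<noteq> i 1" "m \<noteq> i 2" "m \<noteq> i 3" "m \<noteq> i 4"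
    using assms(2) by auto
  then consider "m < i 1" | "i 1 < m" "m < i 2" | "i 2 < m" "m < i 3" | "i 3 < m" "m < i 4" | "i 4 < m"
    by linarith
  then show ?thesis
  proof cases
    case 1 then show ?thesis using assms by (intro bexI[of _ 0]) (auto simp: mesh_pos_def)
  next
    case 2 then show ?thesis by (intro bexI[of _ 1]) (auto simp: mesh_pos_def numeral_2_eq_2)
  next
    case 3 then show ?thesis by (intro bexI[of _ 2]) (auto simp: mesh_pos_def)
  next
    case 4 then show ?thesis by (intro bexI[of _ 3]) (auto simp: mesh_pos_def)
  next
    case 5 then show ?thesis using assms by (intro bexI[of _ 4]) (auto simp: mesh_pos_def)
  qed
qed

text \<open>The shaded rows force the letters 1 and 4 of an occurrence to be the values 1 and n;
  \<open>z a\<close> is the position at which the letter \<open>a\<close> is played.\<close>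

lemma contains_mesh_iff:
  assumes \<pi>: "\<pi> permutes {1..4}" and \<tau>: "\<tau> permutes {1..n}"
    and p: "p = (\<pi>, ({0..4} \<times> {0}) \<union> ({0..4} \<times> {4}))"
  shows "contains_mesh 4 p n \<tau> \<longleftrightarrow>
    (\<exists>z. (\<forall>a\<in>{1..4}. z a \<in> {1..n}) \<and>
         (\<forall>a\<in>{1..4}. \<forall>b\<in>{1..4}. z a < z b \<longleftrightarrow> inv \<pi> a < inv \<pi> b) \<and>
         \<tau> (z 1) = 1 \<and> \<tau> (z 4) = n \<and> \<tau> (z 2) < \<tau> (z 3))"
    (is "_ \<longleftrightarrow> (\<exists>z. ?ok z)")
proof
  assume "contains_mesh 4 p n \<tau>"
  then obtain i where i: "i ` {1..4} \<subseteq> {1..n}" "strict_mono_on {1..4} i"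
    and ord: "\<And>a b. a \<in> {1..4} \<Longrightarrow> b \<in> {1..4} \<Longrightarrow> \<tau> (i a) < \<tau> (i b) \<longleftrightarrow> \<pi> a < \<pi> b"
    and bot: "\<And>x m. x \<in> {0..4} \<Longrightarrow> m \<in> {1..n} \<Longrightarrow> mesh_pos n 4 i x < m \<Longrightarrow>
        m < mesh_pos n 4 i (x + 1) \<Longrightarrow>
        \<not> (mesh_val n 4 \<tau> i 0 < \<tau> m \<and> \<tau> m < mesh_val n 4 \<tau> i 1)"
    and top: "\<And>x m. x \<in> {0..4} \<Longrightarrow> m \<in> {1..n} \<Longrightarrow> mesh_pos n 4 i x < m \<Longrightarrow>
        m < mesh_pos n 4 i (x + 1) \<Longrightarrow>
        \<not> (mesh_val n 4 \<tau> i 4 < \<tau> m \<and> \<tau> m < mesh_val n 4 \<tau> i 5)"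
    unfolding contains_mesh_def mesh_occurrence_def p by (fastforce simp: Ball_def)
  define z where "z = i \<circ> inv \<pi>"
  have inv: "inv \<pi> permutes {1..4}"
    using \<pi> by (rule permutes_inv)
  have in4: "inv \<pi> a \<in> {1..4}" if "a \<in> {1..4}" for a
    using that permutes_in_image[OF inv] by blast
  have z_pi: "z (\<pi> a) = i a" for a
    by (simp add: z_def permutes_inverses[OF \<pi>])
  have zord: "\<tau> (z a) < \<tau> (z b) \<longleftrightarrow> a < b" if "a \<in> {1..4}" "b \<in> {1..4}" for a b
    using ord[OF in4[OF that(1)] in4[OF that(2)]] by (simp add: z_def permutes_inverses[OF \<pi>])
  have zin: "z a \<in> {1..n}" if "a \<in> {1..4}" for a
    using in4[OF that] i(1) unfolding z_def comp_apply by blast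
  have zpos: "z a < z b \<longleftrightarrow> inv \<pi> a < inv \<pi> b" if "a \<in> {1..4}" "b \<in> {1..4}" for a b
    using in4[OF that(1)] in4[OF that(2)] strict_mono_on_less[OF i(2)] by (simp add: z_def)
  note val = mesh_val_of_chain[OF \<pi>, of z i \<tau> n]
  have val1: "mesh_val n 4 \<tau> i 1 = \<tau> (z 1)" and val4: "mesh_val n 4 \<tau> i 4 = \<tau> (z 4)"
    using zord[of 1 2] zord[of 2 3] zord[of 3 4] val[OF z_pi] by simp_all
  have tin: "\<tau> (z a) \<in> {1..n}" if "a \<in> {1..4}" for a
    using zin[OF that] permutes_in_image[OF \<tau>] by blast
  have img: "i ` {1..4} \<subseteq> z ` {1..4}"
    using z_pi permutes_in_image[OF \<pi>] by (metis image_eqI image_subsetI)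
  have no_val: "inv \<tau> c \<notin> i ` {1..4}" if "\<And>a. a \<in> {1..4} \<Longrightarrow> \<tau> (z a) \<noteq> c" for c
    using that img permutes_inverses(1)[OF \<tau>] by (metis imageE subsetD)
  \<comment> \<open>Otherwise the position of the value 1 is unchosen and puts a point into the
    shaded bottom row. The value \<open>n\<close> is treated likewise with the top row.\<close>
  have "\<tau> (z 1) = 1"
  proof (rule ccontr)
    assume "\<tau> (z 1) \<noteq> 1"
    then have g: "1 < \<tau> (z 1)"
      using tin[of 1] by auto
    have "\<tau> (z a) \<noteq> 1" if "a \<in> {1..4}" for a
      using zord[of 1 a] zord[of a 1] that g by (cases "a = 1") auto
    then have "inv \<tau> 1 \<notin> i ` {1..4}"
      by (rule no_val)
    moreover have m: "inv \<tau> 1 \<in> {1..n}"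
      using permutes_in_image[OF permutes_inv[OF \<tau>], of 1] tin[of 1] by auto
    ultimately obtain x where "x \<in> {0..4}" "mesh_pos n 4 i x < inv \<tau> 1"
      "inv \<tau> 1 < mesh_pos n 4 i (x + 1)"
      using ex_mesh_column by blast
    from bot[OF this(1) m this(2,3)] g show False
      unfolding val1 permutes_inverses(1)[OF \<tau>] by (simp add: mesh_val_def)
  qed
  moreover have "\<tau> (z 4) = n"
  proof (rule ccontr)
    assume "\<tau> (z 4) \<noteq> n"
    then have g: "\<tau> (z 4) < n"
      using tin[of 4] by auto
    have "\<tau> (z a) \<noteq> n" if "a \<in> {1..4}" for a
      using zord[of 4 a] zord[of a 4] that g by (cases "a = 4") auto
    then have "inv \<tau> n \<notin> i ` {1..4}"
      by (rule no_val)
    moreover have m: "inv \<tau> n \<in> {1..n}"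
      using permutes_in_image[OF permutes_inv[OF \<tau>], of n] tin[of 1] by auto
    ultimately obtain x where "x \<in> {0..4}" "mesh_pos n 4 i x < inv \<tau> n"
      "inv \<tau> n < mesh_pos n 4 i (x + 1)"
      using ex_mesh_column by blast
    from top[OF this(1) m this(2,3)] g show False
      unfolding val4 permutes_inverses(1)[OF \<tau>] by (simp add: mesh_val_def)
  qed
  ultimately have "?ok z"
    using zin zpos zord[of 2 3] by simp
  then show "\<exists>z. ?ok z"
    by (rule exI[of ?ok z])
next
  assume "\<exists>z. ?ok z"
  then obtain z where z: "\<And>a. a \<in> {1..4} \<Longrightarrow> z a \<in> {1..n}"
    and pos: "\<And>a b. a \<in> {1..4} \<Longrightarrow> b \<in> {1..4} \<Longrightarrow> z a < z b \<longleftrightarrow> inv \<pi> a < inv \<pi> b"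
    and t: "\<tau> (z 1) = 1" "\<tau> (z 4) = n" "\<tau> (z 2) < \<tau> (z 3)"
    by blast
  define i where "i = z \<circ> \<pi>"
  have in4: "\<pi> a \<in> {1..4}" if "a \<in> {1..4}" for a
    using that permutes_in_image[OF \<pi>] by blast
  have tin: "\<tau> (z a) \<in> {1..n}" if "a \<in> {1..4}" for a
    using z[OF that] permutes_in_image[OF \<tau>] by blast
  \<comment> \<open>The order equivalence for both \<open>(a, b)\<close> and \<open>(b, a)\<close>,
    with injectivity of \<open>inv \<pi>\<close>, makes the four positions distinct.\<close>
  have "z a \<noteq> z b" if "a \<in> {1..4}" "b \<in> {1..4}" "a \<noteq> b" for a b
    using pos[OF that(1,2)] pos[OF that(2,1)] that permutes_inj[OF permutes_inv[OF \<pi>]]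
    by (metis injD linorder_less_linear order_less_irrefl)
  then have "\<tau> (z a) \<noteq> \<tau> (z b)" if "a \<in> {1..4}" "b \<in> {1..4}" "a \<noteq> b" for a b
    using that permutes_inj[OF \<tau>] by (meson injD)
  from this[of 1 2] this[of 3 4]
  have chain: "\<tau> (z 1) < \<tau> (z 2)" "\<tau> (z 2) < \<tau> (z 3)" "\<tau> (z 3) < \<tau> (z 4)"
    using t tin[of 2] tin[of 3] by auto
  have val: "mesh_val n 4 \<tau> i 1 = 1" "mesh_val n 4 \<tau> i 4 = n"
    using mesh_val_of_chain[OF \<pi>, of z i \<tau> n] chain t by (simp_all add: i_def)
  have zord: "\<tau> (z a) < \<tau> (z b) \<longleftrightarrow> a < b" if "a \<in> {1..4}" "b \<in> {1..4}" for a b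
  proof -
    have "a \<in> {1, 2, 3, 4}" "b \<in> {1, 2, 3, 4}"
      using that by auto
    then show ?thesis
      using chain by auto
  qed
  have "mesh_occurrence 4 p n \<tau> i"
    unfolding mesh_occurrence_def
  proof (intro conjI)
    show "i ` {1..4} \<subseteq> {1..n}"
      using z in4 by (auto simp: i_def)
    show "strict_mono_on {1..4} i"
      using pos in4 by (auto simp: i_def strict_mono_on_def permutes_inverses[OF \<pi>])
    show "\<forall>a\<in>{1..4}. \<forall>b\<in>{1..4}. (\<tau> (i a) < \<tau> (i b)) = (fst p a < fst p b)"
      using zord in4 by (auto simp: p i_def)
    \<comment> \<open>The bottom row lies strictly between the values 0 and 1, the top row strictly
      between \<open>n\<close> and \<open>n + 1\<close>; neither contains an integer.\<close>
    show "\<forall>(x, y)\<in>snd p. \<not> (\<exists>m\<in>{1..n}.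
        mesh_pos n 4 i x < m \<and> m < mesh_pos n 4 i (x + 1) \<and>
        mesh_val n 4 \<tau> i y < \<tau> m \<and> \<tau> m < mesh_val n 4 \<tau> i (y + 1))"
      using val by (auto simp: p mesh_val_def)
  qed
  then show "contains_mesh 4 p n \<tau>"
    unfolding contains_mesh_def by blast
qed

section \<open>Gaps between the extreme values and adjacency of the letters 2 and 3\<close>

text \<open>Regions 0, 1, 2 are the positions to the left of, between and to the right of \<open>k < l\<close>;
  \<open>region_of q a\<close> is the region, with respect to the letters 1 and 4, in which the letter \<open>a\<close> is
  played when \<open>q\<close> is the inverse of the pattern.\<close>

definition region :: "nat \<Rightarrow> nat \<Rightarrow> nat \<Rightarrow> nat \<Rightarrow> nat set" where
  "region n k l r = (if r = 0 then {1..<k} else if r = 1 then {k<..<l} else {l<..n})"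

definition region_of :: "(nat \<Rightarrow> nat) \<Rightarrow> nat \<Rightarrow> nat" where
  "region_of q a = (if q a < min (q 1) (q 4) then 0 else if q a < max (q 1) (q 4) then 1 else 2)"

lemma region_of_less_3: "region_of q a < 3"
  by (simp add: region_of_def)

lemma permutation4_cases:
  assumes "q permutes {1..4::nat}"
  shows "q 1 \<in> {1,2,3,4}" "q 2 \<in> {1,2,3,4}" "q 3 \<in> {1,2,3,4}" "q 4 \<in> {1,2,3,4}"
    "q 1 \<noteq> q 2" "q 1 \<noteq> q 3" "q 1 \<noteq> q 4" "q 2 \<noteq> q 3" "q 2 \<noteq> q 4" "q 3 \<noteq> q 4"
proof -
  have "q a \<in> {1,2,3,4}" if "a \<in> {1..4}" for a
  proof -
    have "q a \<in> {1..4}"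
      using that permutes_in_image[OF assms] by blast
    then show ?thesis by auto
  qed
  then show "q 1 \<in> {1,2,3,4}" "q 2 \<in> {1,2,3,4}" "q 3 \<in> {1,2,3,4}" "q 4 \<in> {1,2,3,4}"
    by simp_all
qed (simp_all add: inj_eq[OF permutes_inj[OF assms]])

text \<open>The four distinct numbers exhaust 1 to 4, so \<open>b\<close> and \<open>c\<close> are
  consecutive unless \<open>m\<close> or \<open>M\<close> separates them.\<close>

lemma adjacent_iff_between:
  fixes m M b c :: nat
  assumes "m < M" "m \<in> {1..4}" "M \<in> {1..4}" "b \<in> {1..4}" "c \<in> {1..4}"
    "b \<noteq> c" "m \<noteq> b" "m \<noteq> c" "M \<noteq> b" "M \<noteq> c"
  shows "b + 1 = c \<or> c + 1 = b \<longleftrightarrow> (b < m \<longleftrightarrow> c < m) \<and> (b < M \<longleftrightarrow> c < M)"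
proof
  assume same: "(b < m \<longleftrightarrow> c < m) \<and> (b < M \<longleftrightarrow> c < M)"
  have bounds: "1 \<le> m" "M \<le> 4" "1 \<le> b" "b \<le> 4" "1 \<le> c" "c \<le> 4"
    using assms by auto
  consider "b < m" "c < m" | "m < b" "m < c" "b < M" "c < M" | "M < b" "M < c"
    using same assms(1,7-10) by linarith
  then show "b + 1 = c \<or> c + 1 = b"
    by cases (use bounds assms(1,6) in linarith)+
qed (use assms(7-10) in linarith)

text \<open>Converts the case distinction of the theorem into one about gaps: the positions of 2 and
  3 are consecutive when neither the position of 1 nor that of 4 lies between them.\<close>

lemma adjacent_letters_iff_region_of_eq:
  assumes "\<pi> permutes {1..4}"
  shows "adjacent_letters 4 \<pi> 2 3 \<longleftrightarrow> region_of (inv \<pi>) 2 = region_of (inv \<pi>) 3"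
proof -
  let ?q = "inv \<pi>"
  note q = permutation4_cases[OF permutes_inv[OF assms]]
  have eq: "\<pi> j = a \<longleftrightarrow> ?q a = j" for j a
    using permutes_inv_eq[OF assms] by auto
  have in4: "?q 1 \<in> {1..4}" "?q 2 \<in> {1..4}" "?q 3 \<in> {1..4}" "?q 4 \<in> {1..4}"
    using permutes_in_image[OF permutes_inv[OF assms]] by simp_all
  have aux: "(\<exists>j\<in>{1,2,3}. a = j \<and> b = j + 1 \<or> b = j \<and> a = j + 1) \<longleftrightarrow> a + 1 = b \<or> b + 1 = a"
    if "a \<in> {1,2,3,4}" "b \<in> {1,2,3,4}" for a b :: nat
    using that by (elim insertE emptyE) simp_all
  have "{1..<4} = {1, 2, 3::nat}"
    by auto
  then have "adjacent_letters 4 \<pi> 2 3 \<longleftrightarrow> (\<exists>j\<in>{1,2,3}. {\<pi> j, \<pi> (j + 1)} = {2, 3})"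
    unfolding adjacent_letters_def by (simp only:)
  also have "\<dots> \<longleftrightarrow> (\<exists>j\<in>{1,2,3}. ?q 2 = j \<and> ?q 3 = j + 1 \<or> ?q 3 = j \<and> ?q 2 = j + 1)"
    unfolding doubleton_eq_iff eq by blast
  also have "\<dots> \<longleftrightarrow> ?q 2 + 1 = ?q 3 \<or> ?q 3 + 1 = ?q 2"
    using aux[OF q(2,3)] .
  also have "\<dots> \<longleftrightarrow> region_of ?q 2 = region_of ?q 3"
  proof (cases "?q 1 < ?q 4")
    case True
    have "?q 2 + 1 = ?q 3 \<or> ?q 3 + 1 = ?q 2 \<longleftrightarrow> (?q 2 < ?q 1 \<longleftrightarrow> ?q 3 < ?q 1) \<and> (?q 2 < ?q 4 \<longleftrightarrow> ?q 3 < ?q 4)"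
      by (rule adjacent_iff_between[OF True]) (use in4 q in metis)+
    moreover have "min (?q 1) (?q 4) = ?q 1" "max (?q 1) (?q 4) = ?q 4"
      using True by simp_all
    ultimately show ?thesis
      using True unfolding region_of_def by (simp del: One_nat_def)
  next
    case False
    then have less: "?q 4 < ?q 1"
      using q by linarith
    have "?q 2 + 1 = ?q 3 \<or> ?q 3 + 1 = ?q 2 \<longleftrightarrow> (?q 2 < ?q 4 \<longleftrightarrow> ?q 3 < ?q 4) \<and> (?q 2 < ?q 1 \<longleftrightarrow> ?q 3 < ?q 1)"
      by (rule adjacent_iff_between[OF less]) (use in4 q in metis)+
    moreover have "min (?q 1) (?q 4) = ?q 4" "max (?q 1) (?q 4) = ?q 1"
      using less by simp_all
    ultimately show ?thesis
      using less unfolding region_of_def by (simp del: One_nat_def)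
  qed
  finally show ?thesis .
qed

lemma less_if_region_of_less:
  assumes "region_of q a < region_of q b"
  shows "q a < q b"
proof (rule ccontr)
  assume "\<not> q a < q b"
  then have "region_of q b \<le> region_of q a"
    unfolding region_of_def by auto
  with assms show False
    by simp
qed

lemma region_less:
  assumes "r < s" "s < 3" "k < l" "x \<in> region n k l r" "y \<in> region n k l s"
  shows "x < y"
  using assms by (cases "s = 1"; cases "s = 2") (auto simp: region_def split: if_split_asm)

text \<open>With different gaps, the left-to-right order of the letters 2 and 3 is automatic, which
  leaves only the condition on values.\<close>

lemma region_of_less:
  assumes "region_of q 2 \<noteq> region_of q 3" "k < l"
    "x \<in> region n k l (region_of q 2)" "y \<in> region n k l (region_of q 3)"
  shows "x \<noteq> y \<and> (x < y \<longleftrightarrow> q 2 < q 3)"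
proof (cases "region_of q 2 < region_of q 3")
  case True
  then show ?thesis
    using less_if_region_of_less[OF True] region_less[OF True region_of_less_3 assms(2-4)] by simp
next
  case False
  then have gt: "region_of q 3 < region_of q 2"
    using assms(1) by simp
  show ?thesis
    using less_if_region_of_less[OF gt] region_less[OF gt region_of_less_3 assms(2,4,3)] by simp
qed

text \<open>Splitting on the order of \<open>P\<close> and \<open>Q\<close> resolves the minima and
  maxima, so that a region becomes a pair of comparisons.\<close>

lemma region_iff:
  assumes "P \<noteq> Q" "P < Q \<longleftrightarrow> q 1 < q 4" "q 1 \<noteq> q 4" "q a \<noteq> q 1" "q a \<noteq> q 4" "x \<in> {1..n}"
  shows "x \<in> region n (min P Q) (max P Q) (region_of q a) \<longleftrightarrow>
    x \<noteq> P \<and> x \<noteq> Q \<and> (x < P \<longleftrightarrow> q a < q 1) \<and> (x < Q \<longleftrightarrow> q a < q 4)"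
proof (cases "P < Q")
  case True
  then have "min P Q = P" "max P Q = Q" "min (q 1) (q 4) = q 1" "max (q 1) (q 4) = q 4" "q 1 < q 4"
    using assms by auto
  then show ?thesis
    using True assms unfolding region_def region_of_def by auto
next
  case False
  then have "min P Q = Q" "max P Q = P" "min (q 1) (q 4) = q 4" "max (q 1) (q 4) = q 1" "q 4 < q 1" "Q < P"
    using assms by auto
  then show ?thesis
    using assms unfolding region_def region_of_def by auto
qed

text \<open>\<open>P\<close>, \<open>x\<close>, \<open>y\<close>, \<open>Q\<close> are the positions at which the letters 1, 2, 3, 4 are played.\<close>

lemma order_pattern_iff:
  assumes "q permutes {1..4}" "P \<in> {1..n}" "Q \<in> {1..n}" "x \<in> {1..n}" "y \<in> {1..n}"
    and z: "z 1 = P" "z 2 = x" "z 3 = y" "z 4 = Q"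
  shows "(\<forall>a\<in>{1..4}. \<forall>b\<in>{1..4}. (z a :: nat) < z b \<longleftrightarrow> q a < q b) \<longleftrightarrow>
    P \<noteq> Q \<and> (P < Q \<longleftrightarrow> q 1 < q 4) \<and> x \<noteq> y \<and> (x < y \<longleftrightarrow> q 2 < q 3) \<and>
    x \<in> region n (min P Q) (max P Q) (region_of q 2) \<and>
    y \<in> region n (min P Q) (max P Q) (region_of q 3)"
proof -
  note q = permutation4_cases(5-10)[OF assms(1)]
  \<comment> \<open>The comparisons off the diagonal are grouped by the six pairs of letters; in
    each group the two directions amount to distinctness and one equivalence.\<close>
  have pair: "s \<noteq> t \<Longrightarrow> ((u < v \<longleftrightarrow> s < t) \<and> (v < u \<longleftrightarrow> t < s)) \<longleftrightarrow> (u \<noteq> v \<and> (u < v \<longleftrightarrow> s < t))"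
    for u v s t :: nat
    by auto
  have "{1..4} = {1, 2, 3, 4::nat}"
    by auto
  then have "(\<forall>a\<in>{1..4}. \<forall>b\<in>{1..4}. z a < z b \<longleftrightarrow> q a < q b) \<longleftrightarrow>
    ((P < Q \<longleftrightarrow> q 1 < q 4) \<and> (Q < P \<longleftrightarrow> q 4 < q 1)) \<and>
    ((x < y \<longleftrightarrow> q 2 < q 3) \<and> (y < x \<longleftrightarrow> q 3 < q 2)) \<and>
    ((x < P \<longleftrightarrow> q 2 < q 1) \<and> (P < x \<longleftrightarrow> q 1 < q 2)) \<and>
    ((x < Q \<longleftrightarrow> q 2 < q 4) \<and> (Q < x \<longleftrightarrow> q 4 < q 2)) \<and>
    ((y < P \<longleftrightarrow> q 3 < q 1) \<and> (P < y \<longleftrightarrow> q 1 < q 3)) \<and>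
    ((y < Q \<longleftrightarrow> q 3 < q 4) \<and> (Q < y \<longleftrightarrow> q 4 < q 3))"
    by (simp only: ball_simps z less_irrefl simp_thms conj_ac)
  also have "\<dots> \<longleftrightarrow>
    (P \<noteq> Q \<and> (P < Q \<longleftrightarrow> q 1 < q 4)) \<and> (x \<noteq> y \<and> (x < y \<longleftrightarrow> q 2 < q 3)) \<and>
    (x \<noteq> P \<and> (x < P \<longleftrightarrow> q 2 < q 1)) \<and> (x \<noteq> Q \<and> (x < Q \<longleftrightarrow> q 2 < q 4)) \<and>
    (y \<noteq> P \<and> (y < P \<longleftrightarrow> q 3 < q 1)) \<and> (y \<noteq> Q \<and> (y < Q \<longleftrightarrow> q 3 < q 4))"
    by (simp only: pair q q[symmetric] simp_thms)
  also have "\<dots> \<longleftrightarrow> P \<noteq> Q \<and> (P < Q \<longleftrightarrow> q 1 < q 4) \<and> x \<noteq> y \<and> (x < y \<longleftrightarrow> q 2 < q 3) \<and>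
    x \<in> region n (min P Q) (max P Q) (region_of q 2) \<and>
    y \<in> region n (min P Q) (max P Q) (region_of q 3)"
  proof (cases "P \<noteq> Q \<and> (P < Q \<longleftrightarrow> q 1 < q 4)")
    case True
    then show ?thesis
      using region_iff[of P Q q 2 x n] region_iff[of P Q q 3 y n] assms(4,5)
      by (simp only: q q[symmetric] simp_thms) blast
  qed blast
  finally show ?thesis .
qed

section \<open>Number of containing permutations for fixed positions of 1 and
  \<open>n\<close>\<close>

lemma inj_on_perms_at:
  assumes "\<tau> \<in> perms_at n P Q"
  shows "inj_on \<tau> A"
  using assms permutes_inj_on by (auto simp: perms_at_def)

text \<open>Passes from avoidance, which has probability \<open>1 / d\<close>, to containment.
  Keeping the fraction as a product confines division and subtraction in the reals to this
  place.\<close>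

lemma real_card_complement_of_fraction:
  assumes "finite T" "card T = d * card {\<tau> \<in> T. R \<tau>}" "d > 0"
    and "\<And>\<tau>. \<tau> \<in> T \<Longrightarrow> E \<tau> \<longleftrightarrow> \<not> R \<tau>"
  shows "real (card {\<tau> \<in> T. E \<tau>}) = real (card T) * (1 - inverse (real d))"
proof -
  have "{\<tau> \<in> T. E \<tau>} = T - {\<tau> \<in> T. R \<tau>}"
    using assms(4) by auto
  then have "card {\<tau> \<in> T. E \<tau>} = card T - card {\<tau> \<in> T. R \<tau>}"
    using assms(1) by (simp add: card_Diff_subset)
  moreover have "card {\<tau> \<in> T. R \<tau>} \<le> card T"
    using assms(1) by (intro card_mono) auto
  ultimately have "real (card {\<tau> \<in> T. E \<tau>}) = real (card T) - real (card {\<tau> \<in> T. R \<tau>})"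
    by simp
  also have "real (card {\<tau> \<in> T. R \<tau>}) = real (card T) * inverse (real d)"
    using assms(2,3) by (simp add: field_simps)
  finally show ?thesis
    by (simp add: algebra_simps)
qed

text \<open>With the letter 2 confined to \<open>A\<close> and the letter 3 to \<open>B\<close>,
  avoidance means that the values on \<open>A\<close> dominate those on \<open>B\<close>.
  Disjointness excludes equal values.\<close>

lemma card_not_dominating_perms_at:
  assumes "P \<in> {1..n}" "Q \<in> {1..n}" "P \<noteq> Q"
    and "A \<subseteq> {1..n} - {P, Q}" "B \<subseteq> {1..n} - {P, Q}" "A \<inter> B = {}"
  shows "real (card {\<tau> \<in> perms_at n P Q. \<exists>x\<in>A. \<exists>y\<in>B. \<tau> x < \<tau> y}) =
    fact (n - 2) * (1 - inverse (real ((card A + card B) choose card A)))"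
proof -
  have fin: "finite A" "finite B"
    using assms(4,5) by (auto intro: finite_subset)
  have frac: "card (perms_at n P Q) = ((card A + card B) choose card A) *
      card {\<tau> \<in> perms_at n P Q. \<forall>a\<in>A. \<forall>b\<in>B. \<tau> b < \<tau> a}"
    using assms(4-6) by (intro card_dominating finite_perms_at fin inj_on_perms_at)
      (auto elim!: perms_at_comp)
  have iff: "(\<exists>x\<in>A. \<exists>y\<in>B. \<tau> x < \<tau> y) \<longleftrightarrow> \<not> (\<forall>a\<in>A. \<forall>b\<in>B. \<tau> b < \<tau> a)"
    if \<tau>: "\<tau> \<in> perms_at n P Q" for \<tau>
  proof -
    have "\<tau> x < \<tau> y \<longleftrightarrow> \<not> \<tau> y < \<tau> x" if "x \<in> A" "y \<in> B" for x y
    proof -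
      have "x \<noteq> y"
        using that assms(6) by blast
      then have "\<tau> x \<noteq> \<tau> y"
        using inj_on_perms_at[OF \<tau>, of UNIV] by (simp add: inj_eq)
      then show ?thesis
        by linarith
    qed
    then show ?thesis
      by blast
  qed
  show ?thesis
    using real_card_complement_of_fraction[OF finite_perms_at frac _ iff]
    by (simp add: card_perms_at[OF assms(1-3)])
qed

text \<open>A pair with \<open>v y < v x\<close> and \<open>\<tau> x < \<tau> y\<close> is an
  inversion of \<open>\<tau>\<close> relative to the key \<open>v\<close>, so avoidance is
  monotonicity along \<open>v\<close>.\<close>

lemma card_not_monotone_perms_at:
  fixes v :: "nat \<Rightarrow> 'c::linorder"
  assumes "P \<in> {1..n}" "Q \<in> {1..n}" "P \<noteq> Q" "A \<subseteq> {1..n} - {P, Q}" "inj_on v A"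
  shows "real (card {\<tau> \<in> perms_at n P Q. \<exists>x\<in>A. \<exists>y\<in>A. v y < v x \<and> \<tau> x < \<tau> y}) =
    fact (n - 2) * (1 - 1 / fact (card A))"
proof -
  have fin: "finite A"
    using assms(4) by (auto intro: finite_subset)
  have frac: "card (perms_at n P Q) = fact (card A) *
      card {\<tau> \<in> perms_at n P Q. \<forall>a\<in>A. \<forall>b\<in>A. v a < v b \<longrightarrow> \<tau> a < \<tau> b}"
    using assms(4,5) by (intro card_monotone finite_perms_at fin inj_on_perms_at)
      (auto elim!: perms_at_comp)
  have iff: "(\<exists>x\<in>A. \<exists>y\<in>A. v y < v x \<and> \<tau> x < \<tau> y) \<longleftrightarrow>
      \<not> (\<forall>a\<in>A. \<forall>b\<in>A. v a < v b \<longrightarrow> \<tau> a < \<tau> b)"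
    if \<tau>: "\<tau> \<in> perms_at n P Q" for \<tau>
  proof -
    have "\<tau> x < \<tau> y \<longleftrightarrow> \<not> \<tau> y < \<tau> x" if "v y < v x" for x y
    proof -
      have "x \<noteq> y"
        using that by blast
      then have "\<tau> x \<noteq> \<tau> y"
        using inj_on_perms_at[OF \<tau>, of UNIV] by (simp add: inj_eq)
      then show ?thesis
        by linarith
    qed
    then show ?thesis
      by blast
  qed
  show ?thesis
    using real_card_complement_of_fraction[OF finite_perms_at frac _ iff]
    by (simp add: card_perms_at[OF assms(1-3)] inverse_eq_divide)
qed

section \<open>Decomposition by the positions of 1 and \<open>n\<close>\<close>

definition pairs :: "nat \<Rightarrow> (nat \<times> nat) set" where
  "pairs n = {(k, l). 1 \<le> k \<and> k < l \<and> l \<le> n}"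

lemma finite_pairs: "finite (pairs n)"
  by (rule finite_subset[of _ "{1..n} \<times> {1..n}"]) (auto simp: pairs_def)

lemma region_subset:
  assumes "(k, l) \<in> pairs n"
  shows "region n k l r \<subseteq> {1..n} - {k, l}"
  using assms by (auto simp: pairs_def region_def)

definition gap :: "nat \<Rightarrow> nat \<Rightarrow> nat \<Rightarrow> nat \<Rightarrow> nat" where
  "gap n k l r = (if r = 0 then k - 1 else if r = 1 then l - k - 1 else n - l)"

lemma card_region: "card (region n k l r) = gap n k l r"
  by (simp add: region_def gap_def)

text \<open>Each containing permutation belongs to exactly one pair, namely the sorted positions of
  its values 1 and \<open>n\<close>. \<open>P\<close> and \<open>Q\<close> undo the sorting: the
  value 1 comes first precisely when the letter 1 precedes the letter 4 in
  \<open>\<pi>\<close>.\<close>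

lemma s_plus_eq_sum:
  fixes \<pi> :: "nat \<Rightarrow> nat"
  assumes \<pi>: "\<pi> permutes {1..4}" and p: "p = (\<pi>, ({0..4} \<times> {0}) \<union> ({0..4} \<times> {4}))"
    and "n \<ge> 1"
  defines "q \<equiv> inv \<pi>"
  defines "P \<equiv> \<lambda>k l. if q 1 < q 4 then k else l" and "Q \<equiv> \<lambda>k l. if q 1 < q 4 then l else (k :: nat)"
  shows "s_plus 4 p n = (\<Sum>(k, l)\<in>pairs n. card {\<tau> \<in> perms_at n (P k l) (Q k l).
      \<exists>x\<in>region n k l (region_of q 2). \<exists>y\<in>region n k l (region_of q 3).
        (x \<noteq> y \<and> (x < y \<longleftrightarrow> q 2 < q 3)) \<and> \<tau> x < \<tau> y})"
    (is "_ = (\<Sum>(k, l)\<in>_. card (?S k l))")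
proof -
  have q: "q permutes {1..4}"
    unfolding q_def using \<pi> by (rule permutes_inv)
  have q14: "q 1 \<noteq> q 4"
    using permutation4_cases[OF q] by simp
  have contains: "contains_mesh 4 p n \<tau> \<longleftrightarrow> (\<exists>(k, l)\<in>pairs n. \<tau> \<in> ?S k l)"
    if \<tau>: "\<tau> permutes {1..n}" for \<tau>
  proof
    assume "contains_mesh 4 p n \<tau>"
    then obtain z where z: "\<forall>a\<in>{1..4}. z a \<in> {1..n}"
      and ord: "\<forall>a\<in>{1..4}. \<forall>b\<in>{1..4}. z a < z b \<longleftrightarrow> q a < q b"
      and vals: "\<tau> (z 1) = 1" "\<tau> (z 4) = n" "\<tau> (z 2) < \<tau> (z 3)"
      unfolding contains_mesh_iff[OF \<pi> \<tau> p] q_def by blast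
    have zin: "z 1 \<in> {1..n}" "z 2 \<in> {1..n}" "z 3 \<in> {1..n}" "z 4 \<in> {1..n}"
      using z by simp_all
    define k l where "k = min (z 1) (z 4)" and "l = max (z 1) (z 4)"
    note pat = iffD1[OF order_pattern_iff[OF q zin(1,4,2,3) refl refl refl refl] ord,
        folded k_def l_def]
    have "P k l = z 1" "Q k l = z 4"
      using pat by (auto simp: P_def Q_def k_def l_def)
    then have "\<tau> \<in> ?S k l"
      using \<tau> vals pat unfolding perms_at_def mem_Collect_eq by (auto simp del: One_nat_def)
    moreover have "(k, l) \<in> pairs n"
      using zin pat by (auto simp: pairs_def k_def l_def)
    ultimately show "\<exists>(k, l)\<in>pairs n. \<tau> \<in> ?S k l"
      by blast
  next
    assume "\<exists>(k, l)\<in>pairs n. \<tau> \<in> ?S k l"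
    then obtain k l x y where kl: "(k, l) \<in> pairs n" and at: "\<tau> \<in> perms_at n (P k l) (Q k l)"
      and reg: "x \<in> region n k l (region_of q 2)" "y \<in> region n k l (region_of q 3)"
      and xy: "x \<noteq> y" "x < y \<longleftrightarrow> q 2 < q 3" "\<tau> x < \<tau> y"
      by blast
    have PQ: "P k l \<in> {1..n}" "Q k l \<in> {1..n}" "P k l \<noteq> Q k l"
        "P k l < Q k l \<longleftrightarrow> q 1 < q 4" "min (P k l) (Q k l) = k" "max (P k l) (Q k l) = l"
      using kl by (auto simp: P_def Q_def pairs_def)
    have xyin: "x \<in> {1..n}" "y \<in> {1..n}"
      using reg region_subset[OF kl] by blast+
    \<comment> \<open>The default \<open>Q k l\<close> is meant for the letter 4; the other
      arguments that reach it are never consulted.\<close>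
    define z where "z a = (if a = 1 then P k l else if a = 2 then x else if a = 3 then y else Q k l)"
      for a :: nat
    have z: "z 1 = P k l" "z 2 = x" "z 3 = y" "z 4 = Q k l"
      by (simp_all add: z_def)
    have "\<forall>a\<in>{1..4}. \<forall>b\<in>{1..4}. z a < z b \<longleftrightarrow> q a < q b"
      unfolding order_pattern_iff[OF q PQ(1,2) xyin z] using PQ reg xy by simp
    moreover have "\<forall>a\<in>{1..4}. z a \<in> {1..n}"
      using PQ xyin by (auto simp: z_def)
    moreover have "\<tau> (z 1) = 1" "\<tau> (z 4) = n" "\<tau> (z 2) < \<tau> (z 3)"
      unfolding z using at xy by (simp_all add: perms_at_def)
    ultimately show "contains_mesh 4 p n \<tau>"
      unfolding contains_mesh_iff[OF \<pi> \<tau> p] q_def by blast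
  qed
  have "{\<tau>. \<tau> permutes {1..n} \<and> contains_mesh 4 p n \<tau>} = (\<Union>kl\<in>pairs n. ?S (fst kl) (snd kl))"
  proof -
    \<comment> \<open>The equivalence \<open>contains\<close> is available only for permutations;
      this propositional step turns it into an equality of sets.\<close>
    have restrict: "A \<and> B \<longleftrightarrow> C" if "A \<Longrightarrow> B \<longleftrightarrow> C" "C \<Longrightarrow> A" for A B C :: bool
      using that by blast
    have "\<tau> permutes {1..n}" if "\<exists>(k, l)\<in>pairs n. \<tau> \<in> ?S k l" for \<tau>
      using that by (auto simp: perms_at_def)
    from restrict[OF contains this] have "\<tau> permutes {1..n} \<and> contains_mesh 4 p n \<tau> \<longleftrightarrow>
        (\<exists>(k, l)\<in>pairs n. \<tau> \<in> ?S k l)" for \<tau>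
      .
    moreover have "\<tau> \<in> (\<Union>kl\<in>pairs n. ?S (fst kl) (snd kl)) \<longleftrightarrow> (\<exists>(k, l)\<in>pairs n. \<tau> \<in> ?S k l)" for \<tau>
      unfolding UN_iff case_prod_beta ..
    ultimately show ?thesis
      by (intro set_eqI trans[OF mem_Collect_eq]) (rule trans[OF _ sym])
  qed
  then have "s_plus 4 p n = card (\<Union>kl\<in>pairs n. ?S (fst kl) (snd kl))"
    by (simp add: s_plus_def)
  also have "\<dots> = (\<Sum>kl\<in>pairs n. card (?S (fst kl) (snd kl)))"
  proof (rule card_UN_disjoint[OF finite_pairs])
    show "\<forall>kl\<in>pairs n. finite (?S (fst kl) (snd kl))"
      using finite_perms_at by (auto intro: finite_subset)
    \<comment> \<open>By injectivity the positions of the values 1 and \<open>n\<close> are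
      determined by \<open>\<tau>\<close>, hence so is the pair; the summands count disjoint
      sets.\<close>
    have same: "k = k' \<and> l = l'" if "\<tau> \<in> ?S k l" "\<tau> \<in> ?S k' l'" for \<tau> k l k' l'
    proof -
      have perm: "\<tau> \<in> perms_at n (P k l) (Q k l)" "\<tau> \<in> perms_at n (P k' l') (Q k' l')"
        using that by blast+
      then have "\<tau> (P k l) = \<tau> (P k' l')" "\<tau> (Q k l) = \<tau> (Q k' l')"
        by (simp_all add: perms_at_def)
      then have "P k l = P k' l'" "Q k l = Q k' l'"
        using inj_on_perms_at[OF perm(1), of UNIV] by (auto dest: injD)
      then show ?thesis
        by (auto simp: P_def Q_def split: if_splits)
    qed
    show "\<forall>kl\<in>pairs n. \<forall>kl'\<in>pairs n. kl \<noteq> kl' \<longrightarrow>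
        ?S (fst kl) (snd kl) \<inter> ?S (fst kl') (snd kl') = {}"
    proof (intro ballI impI equals0I)
      fix kl kl' \<tau>
      assume "kl \<noteq> kl'" and \<tau>: "\<tau> \<in> ?S (fst kl) (snd kl) \<inter> ?S (fst kl') (snd kl')"
      from same[OF IntD1[OF \<tau>] IntD2[OF \<tau>]] have "kl = kl'"
        by (simp add: prod_eq_iff)
      with \<open>kl \<noteq> kl'\<close> show False ..
    qed
  qed
  finally show ?thesis
    by (simp add: case_prod_beta)
qed

lemma s_plus_nonadjacent:
  assumes \<pi>: "\<pi> permutes {1..4}" and p: "p = (\<pi>, ({0..4} \<times> {0}) \<union> ({0..4} \<times> {4}))"
    and "n \<ge> 1" and ne: "region_of (inv \<pi>) 2 \<noteq> region_of (inv \<pi>) 3"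
  defines "r \<equiv> region_of (inv \<pi>) 2" and "s \<equiv> region_of (inv \<pi>) 3"
  shows "real (s_plus 4 p n) = fact (n - 2) * (\<Sum>(k, l)\<in>pairs n.
      1 - inverse (real ((gap n k l r + gap n k l s) choose gap n k l r)))"
proof -
  let ?q = "inv \<pi>"
  let ?P = "\<lambda>k l. if ?q 1 < ?q 4 then k else l" and ?Q = "\<lambda>k l. if ?q 1 < ?q 4 then l else k"
  have "real (card {\<tau> \<in> perms_at n (?P k l) (?Q k l).
        \<exists>x\<in>region n k l r. \<exists>y\<in>region n k l s. (x \<noteq> y \<and> (x < y \<longleftrightarrow> ?q 2 < ?q 3)) \<and> \<tau> x < \<tau> y}) =
      fact (n - 2) * (1 - inverse (real ((gap n k l r + gap n k l s) choose gap n k l r)))"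
    if kl: "(k, l) \<in> pairs n" for k l
  proof -
    have less: "x \<noteq> y \<and> (x < y \<longleftrightarrow> ?q 2 < ?q 3)" if "x \<in> region n k l r" "y \<in> region n k l s" for x y
      using region_of_less[OF ne _ that[unfolded r_def s_def]] kl by (simp add: pairs_def)
    then have eq: "{\<tau> \<in> perms_at n (?P k l) (?Q k l).
        \<exists>x\<in>region n k l r. \<exists>y\<in>region n k l s. (x \<noteq> y \<and> (x < y \<longleftrightarrow> ?q 2 < ?q 3)) \<and> \<tau> x < \<tau> y} =
        {\<tau> \<in> perms_at n (?P k l) (?Q k l). \<exists>x\<in>region n k l r. \<exists>y\<in>region n k l s. \<tau> x < \<tau> y}"
      by blast
    have disj: "region n k l r \<inter> region n k l s = {}"
      using less by blast
    have PQ: "?P k l \<in> {1..n}" "?Q k l \<in> {1..n}" "?P k l \<noteq> ?Q k l"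
      using kl by (auto simp: pairs_def)
    have sub: "region n k l t \<subseteq> {1..n} - {?P k l, ?Q k l}" for t
      using region_subset[OF kl] by auto
    show ?thesis
      unfolding eq card_region[symmetric] by (rule card_not_dominating_perms_at[OF PQ sub sub disj])
  qed
  then show ?thesis
    unfolding s_plus_eq_sum[OF \<pi> p \<open>n \<ge> 1\<close>] r_def s_def
    by (simp add: case_prod_beta sum_distrib_left)
qed

lemma s_plus_adjacent:
  assumes \<pi>: "\<pi> permutes {1..4}" and p: "p = (\<pi>, ({0..4} \<times> {0}) \<union> ({0..4} \<times> {4}))"
    and "n \<ge> 1" and eq: "region_of (inv \<pi>) 2 = region_of (inv \<pi>) 3"
  shows "real (s_plus 4 p n) =
    fact (n - 2) * (\<Sum>(k, l)\<in>pairs n. 1 - 1 / fact (gap n k l (region_of (inv \<pi>) 3)))"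
proof -
  let ?q = "inv \<pi>" and ?r = "region_of (inv \<pi>) 3"
  let ?P = "\<lambda>k l. if ?q 1 < ?q 4 then k else l" and ?Q = "\<lambda>k l. if ?q 1 < ?q 4 then l else k"
  \<comment> \<open>Negating positions when 2 precedes 3 makes \<open>v y < v x\<close> express the
    required order of \<open>x\<close> and \<open>y\<close> in both cases; integers allow the
    negation.\<close>
  define v where "v x = (if ?q 2 < ?q 3 then - int x else int x)" for x
  have v: "x \<noteq> y \<and> (x < y \<longleftrightarrow> ?q 2 < ?q 3) \<longleftrightarrow> v y < v x" for x y
    by (auto simp: v_def)
  have "inj v"
    by (auto simp: v_def inj_def)
  then have inj: "inj_on v A" for A
    by (rule inj_on_subset) simp
  have "real (card {\<tau> \<in> perms_at n (?P k l) (?Q k l).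
        \<exists>x\<in>region n k l ?r. \<exists>y\<in>region n k l ?r. v y < v x \<and> \<tau> x < \<tau> y}) =
      fact (n - 2) * (1 - 1 / fact (gap n k l ?r))"
    if kl: "(k, l) \<in> pairs n" for k l
  proof -
    have PQ: "?P k l \<in> {1..n}" "?Q k l \<in> {1..n}" "?P k l \<noteq> ?Q k l"
      using kl by (auto simp: pairs_def)
    have "region n k l ?r \<subseteq> {1..n} - {?P k l, ?Q k l}"
      using region_subset[OF kl] by auto
    then show ?thesis
      unfolding card_region[symmetric] by (intro card_not_monotone_perms_at PQ inj)
  qed
  then show ?thesis
    unfolding s_plus_eq_sum[OF \<pi> p \<open>n \<ge> 1\<close>] eq v
    by (simp add: case_prod_beta sum_distrib_left)
qed

section \<open>Symmetry of the sums in the three gap sizes\<close>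

text \<open>For fixed \<open>l\<close>, the reflection of \<open>k\<close> to \<open>l - k\<close>
  is an involution that exchanges the two gap sizes.\<close>

lemma sum_pairs_swap_left_middle:
  "(\<Sum>(k, l)\<in>pairs n. G (l - k - 1) (k - 1) (n - l)) = (\<Sum>(k, l)\<in>pairs n. G (k - 1) (l - k - 1) (n - l))"
  by (rule sum.reindex_bij_witness[where i = "\<lambda>(k, l). (l - k, l)" and j = "\<lambda>(k, l). (l - k, l)"])
    (auto simp: pairs_def)

text \<open>For fixed \<open>k\<close>, reflecting \<open>l\<close> within the positions from
  \<open>k + 1\<close> to \<open>n\<close> exchanges the other two gap sizes.\<close>

lemma sum_pairs_swap_middle_right:
  "(\<Sum>(k, l)\<in>pairs n. G (k - 1) (n - l) (l - k - 1)) = (\<Sum>(k, l)\<in>pairs n. G (k - 1) (l - k - 1) (n - l))"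
  by (rule sum.reindex_bij_witness[where i = "\<lambda>(k, l). (k, n + 1 + k - l)"
        and j = "\<lambda>(k, l). (k, n + 1 + k - l)"])
    (auto simp: pairs_def)

lemma sum_pairs_gap:
  fixes F :: "nat \<Rightarrow> real"
  assumes "r < 3"
  shows "(\<Sum>(k, l)\<in>pairs n. F (gap n k l r)) = (\<Sum>(k, l)\<in>pairs n. F (k - 1))"
proof -
  have "r = 0 \<or> r = 1 \<or> r = 2"
    using assms by auto
  then show ?thesis
    using sum_pairs_swap_left_middle[of "\<lambda>a b c. F a" n]
      sum_pairs_swap_middle_right[of "\<lambda>a b c. F b" n]
    by (auto simp: gap_def)
qed

text \<open>Commutativity of \<open>F\<close> reduces to \<open>r < s\<close>; the two exchanges
  then carry each of the three remaining pairs of gaps to left and middle.\<close>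

lemma sum_pairs_gap_gap:
  fixes F :: "nat \<Rightarrow> nat \<Rightarrow> real"
  assumes "r < 3" "s < 3" "r \<noteq> s" and comm: "\<And>a b. F a b = F b a"
  shows "(\<Sum>(k, l)\<in>pairs n. F (gap n k l r) (gap n k l s)) = (\<Sum>(k, l)\<in>pairs n. F (k - 1) (l - k - 1))"
proof -
  have middle_right: "(\<Sum>(k, l)\<in>pairs n. F (k - 1) (n - l)) = (\<Sum>(k, l)\<in>pairs n. F (k - 1) (l - k - 1))"
    using sum_pairs_swap_middle_right[of "\<lambda>a b c. F a b" n] .
  have left_middle: "(\<Sum>(k, l)\<in>pairs n. F (l - k - 1) (n - l)) = (\<Sum>(k, l)\<in>pairs n. F (k - 1) (n - l))"
    using sum_pairs_swap_left_middle[of "\<lambda>a b c. F a c" n] .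
  have increasing: "(\<Sum>(k, l)\<in>pairs n. F (gap n k l i) (gap n k l j)) =
      (\<Sum>(k, l)\<in>pairs n. F (k - 1) (l - k - 1))" if "i < j" "j < 3" for i j
  proof -
    consider "i = 0" "j = 1" | "i = 0" "j = 2" | "i = 1" "j = 2"
      using \<open>i < j\<close> \<open>j < 3\<close> by linarith
    then show ?thesis
      using middle_right left_middle by cases (simp_all add: gap_def)
  qed
  show ?thesis
  proof (cases "r < s")
    case True
    then show ?thesis
      using increasing assms(2) by blast
  next
    case False
    have "(\<Sum>(k, l)\<in>pairs n. F (gap n k l r) (gap n k l s)) =
        (\<Sum>(k, l)\<in>pairs n. F (gap n k l s) (gap n k l r))"
      by (intro sum.cong refl) (auto intro: comm)
    then show ?thesis
      using increasing[of s r] False assms(1,3) by simp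
  qed
qed

section \<open>Bounds on avoidance probabilities and the limit\<close>

lemma pairs_eq_Sigma: "pairs n = (SIGMA k:{1..n}. {k+1..n})"
  by (auto simp: pairs_def)

lemma sum_pairs_columns:
  "(\<Sum>(k, l)\<in>pairs n. f k l) = (\<Sum>l=1..n. \<Sum>k=1..<l. f k l)"
proof -
  have "(\<Sum>l=1..n. \<Sum>k=1..<l. f k l) = (\<Sum>(l, k)\<in>(SIGMA l:{1..n}. {1..<l}). f k l)"
    by (rule sum.Sigma) auto
  also have "\<dots> = (\<Sum>(k, l)\<in>pairs n. f k l)"
    by (rule sum.reindex_bij_witness[where i = prod.swap and j = prod.swap]) (auto simp: pairs_def)
  finally show ?thesis ..
qed

lemma sum_pairs_one: "(\<Sum>(k, l)\<in>pairs n. 1 :: real) = real n * (real n - 1) / 2"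
  unfolding sum_pairs_columns
  by (induction n) (auto simp: field_simps)

text \<open>Pascal's rule adds a positive coefficient to one that is at least \<open>m\<close> by
  induction; for \<open>j = m\<close> the coefficient is \<open>Suc m\<close> itself.\<close>

lemma le_binomial:
  assumes "0 < j" "j < m"
  shows "m \<le> m choose j"
  using assms
proof (induction m arbitrary: j)
  case (Suc m)
  obtain i where j: "j = Suc i"
    using Suc.prems by (cases j) auto
  show ?case
  proof (cases "j = m")
    case True
    then show ?thesis
      by simp
  next
    case False
    then have "m \<le> m choose Suc i" "m choose i > 0"
      using Suc j by auto
    then show ?thesis
      unfolding j binomial_Suc_Suc by linarith
  qed
qed simp

text \<open>The two end terms are 1 each and every inner term is at most \<open>1 / m\<close>.
  Allowing \<open>1 / m\<close> at the ends as well gives the total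
  \<open>(m + 1) / m + 2\<close>.\<close>

lemma sum_inverse_binomial_le: "(\<Sum>j\<le>m. inverse (real (m choose j))) \<le> 4"
proof (cases "m = 0")
  case False
  have "(\<Sum>j\<le>m. inverse (real (m choose j))) \<le>
      (\<Sum>j\<le>m. 1 / real m + (if j = 0 then 1 else 0) + (if j = m then 1 else 0))"
  proof (rule sum_mono)
    fix j
    assume "j \<in> {..m}"
    then consider "j = 0" | "j = m" | "0 < j" "j < m"
      by fastforce
    then show "inverse (real (m choose j)) \<le> 1 / real m + (if j = 0 then 1 else 0) + (if j = m then 1 else 0)"
    proof cases
      case 3
      then have "inverse (real (m choose j)) \<le> inverse (real m)"
        using le_binomial[OF 3] False by (intro le_imp_inverse_le) auto
      with 3 show ?thesis
        by (simp add: inverse_eq_divide)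
    qed auto
  qed
  also have "\<dots> = (real m + 1) / real m + 2"
    by (simp add: sum.distrib)
  also have "\<dots> \<le> 4"
    using False by (simp add: field_simps)
  finally show ?thesis .
qed simp

lemma sum_inverse_fact_le: "(\<Sum>j<m. 1 / fact j :: real) \<le> 4"
proof -
  have "(\<Sum>j<m. 1 / fact j :: real) \<le> (\<Sum>j. 1 / fact j)"
    using summable_exp[of "1 :: real"] by (intro sum_le_suminf) (auto simp: inverse_eq_divide)
  also have "\<dots> = exp (1 :: real)"
    by (simp add: exp_def inverse_eq_divide)
  also have "\<dots> \<le> 4"
    using exp_le by linarith
  finally show ?thesis .
qed

text \<open>The columns bound the total of \<open>h\<close> over \<open>pairs n\<close> by
  \<open>4 * n\<close>, while the constant 1 contributes \<open>n * (n - 1) / 2\<close>. Dividing by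
  \<open>n * (n - 1)\<close> leaves an error of order \<open>1 / n\<close>.\<close>

lemma limit_of_bounded_columns:
  fixes h :: "nat \<Rightarrow> nat \<Rightarrow> real" and X :: "nat \<Rightarrow> real"
  assumes h0: "\<And>k l. 0 \<le> h k l" and h4: "\<And>l. (\<Sum>k=1..<l. h k l) \<le> 4"
    and X: "\<And>n. n \<ge> 1 \<Longrightarrow> X n = fact (n - 2) * (\<Sum>(k, l)\<in>pairs n. 1 - h k l)"
  shows "(\<lambda>n. X n / fact n) \<longlonglongrightarrow> 1 / 2"
proof -
  define E where "E n = (\<Sum>(k, l)\<in>pairs n. h k l)" for n
  have E0: "0 \<le> E n" for n
    unfolding E_def by (intro sum_nonneg) (auto simp: h0)
  have E4: "E n \<le> 4 * real n" for n
  proof -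
    have "E n \<le> (\<Sum>l=1..n. 4)"
      unfolding E_def sum_pairs_columns by (intro sum_mono h4)
    then show ?thesis
      by simp
  qed
  have val: "X n / fact n = 1 / 2 - E n / (real n * (real n - 1))" if n: "n \<ge> 2" for n
  proof -
    obtain m where m: "n = Suc (Suc m)"
      using n by (metis add_2_eq_Suc le_Suc_ex)
    then have fact_n: "fact n = real n * (real n - 1) * fact m" and n1: "n \<ge> 1"
      by simp_all
    have "(\<Sum>(k, l)\<in>pairs n. 1 - h k l) = real n * (real n - 1) / 2 - E n"
      unfolding E_def sum_pairs_one[symmetric] by (simp add: case_prod_beta sum_subtractf)
    then have "X n / fact n = fact m * (real n * (real n - 1) / 2 - E n) / (real n * (real n - 1) * fact m)"
      unfolding X[OF n1] fact_n by (simp add: m)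
    also have "\<dots> = (real n * (real n - 1) / 2 - E n) / (real n * (real n - 1))"
      by simp
    also have "\<dots> = 1 / 2 - E n / (real n * (real n - 1))"
      using n by (simp add: diff_divide_distrib)
    finally show ?thesis .
  qed
  \<comment> \<open>The 8 comes from \<open>n - 1 \<ge> n / 2\<close> for
    \<open>n \<ge> 2\<close>.\<close>
  have "E n / (real n * (real n - 1)) \<le> 8 / real n" if n: "n \<ge> 2" for n
  proof -
    have "E n / (real n * (real n - 1)) \<le> 4 * real n / (real n * (real n - 1))"
      using E4[of n] n by (intro divide_right_mono) auto
    also have "\<dots> \<le> 8 / real n"
      using n by (simp add: field_simps)
    finally show ?thesis .
  qed
  then have "\<forall>\<^sub>F n in sequentially. E n / (real n * (real n - 1)) \<le> 8 / real n"
    by (auto intro: eventually_sequentiallyI[of 2])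
  moreover have "\<forall>\<^sub>F n in sequentially. 0 \<le> E n / (real n * (real n - 1))"
    by (rule eventually_sequentiallyI[of 2]) (auto intro!: divide_nonneg_nonneg E0)
  ultimately have "(\<lambda>n. E n / (real n * (real n - 1))) \<longlonglongrightarrow> 0"
    using lim_const_over_n[of "8 :: real"] by (rule_tac tendsto_sandwich[OF _ _ tendsto_const])
  then have "(\<lambda>n. 1 / 2 - E n / (real n * (real n - 1))) \<longlonglongrightarrow> 1 / 2 - 0"
    by (intro tendsto_diff tendsto_const)
  then show ?thesis
    using val by (subst tendsto_cong[where g = "\<lambda>n. 1 / 2 - E n / (real n * (real n - 1))"])
      (auto intro: eventually_sequentiallyI[of 2])
qed

section \<open>The two formulas and their common limit\<close>

theorem theorem4p3:
  fixes \<pi> :: "nat \<Rightarrow> nat" and R :: "(nat \<times> nat) set" and p :: mesh_pattern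
  assumes "\<pi> permutes {1..4}"
    and "R = ({0..4} \<times> {0}) \<union> ({0..4} \<times> {4})"
    and "p = (\<pi>, R)"
  shows "(\<not> adjacent_letters 4 \<pi> 2 3 \<longrightarrow>
           (\<forall>n\<ge>4. real (s_plus 4 p n) =
              fact (n - 2) * (\<Sum>k=2..n-2. \<Sum>l=k+1..n-1.
                1 - inverse (real ((n - l + k - 1) choose (k - 1)))))) \<and>
         (adjacent_letters 4 \<pi> 2 3 \<longrightarrow>
           (\<forall>n\<ge>4. real (s_plus 4 p n) =
              fact (n - 2) * (\<Sum>k=3..n-1. real (n - k) * (1 - 1 / fact (k - 1))))) \<and>
         (\<lambda>n. real (s_plus 4 p n) / fact n) \<longlonglongrightarrow> 1 / 2"
proof (cases "adjacent_letters 4 \<pi> 2 3")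
  case False
  \<comment> \<open>The probability of containment when the letters 2 and 3 use different gaps of
    sizes \<open>a\<close> and \<open>b\<close>; its symmetry permits any choice of the two
    gaps.\<close>
  define F where "F a b = 1 - inverse (real ((a + b) choose a))" for a b
  have F_comm: "F a b = F b a" for a b
    using binomial_symmetric[of a "a + b"] by (simp add: F_def add.commute)
  have ne: "region_of (inv \<pi>) 2 \<noteq> region_of (inv \<pi>) 3"
    using False adjacent_letters_iff_region_of_eq[OF assms(1)] by blast
  have s: "real (s_plus 4 p n) = fact (n - 2) * (\<Sum>(k, l)\<in>pairs n. F (k - 1) (l - k - 1))"
    if "n \<ge> 1" for n
    using s_plus_nonadjacent[OF assms(1) assms(3)[unfolded assms(2)] that ne]
      sum_pairs_gap_gap[OF region_of_less_3 region_of_less_3 ne F_comm, where n = n]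
    by (simp add: F_def)
  have "real (s_plus 4 p n) = fact (n - 2) * (\<Sum>k=2..n-2. \<Sum>l=k+1..n-1.
      1 - inverse (real ((n - l + k - 1) choose (k - 1))))" if n: "n \<ge> 4" for n
  proof -
    \<comment> \<open>The stated formula arises from the left and right gaps, of sizes
      \<open>k - 1\<close> and \<open>n - l\<close>.\<close>
    have "(\<Sum>(k, l)\<in>pairs n. F (k - 1) (l - k - 1)) = (\<Sum>(k, l)\<in>pairs n. F (k - 1) (n - l))"
      using sum_pairs_gap_gap[where r = 0 and s = 2 and F = F and n = n, OF _ _ _ F_comm] by (simp add: gap_def)
    also have "\<dots> = (\<Sum>(k, l)\<in>(SIGMA k:{2..n-2}. {k+1..n-1}). F (k - 1) (n - l))"
    proof (rule sum.mono_neutral_right[OF finite_pairs])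
      show "(SIGMA k:{2..n-2}. {k+1..n-1}) \<subseteq> pairs n"
        by (auto simp: pairs_def)
      have "F (k - 1) (n - l) = 0" if "(k, l) \<in> pairs n" "(k, l) \<notin> (SIGMA k:{2..n-2}. {k+1..n-1})" for k l
      proof -
        \<comment> \<open>One of the two gaps is then empty, so the binomial coefficient is 1. The
          value \<open>k = n - 1\<close> is included, as it forces \<open>l = n\<close>.\<close>
        have "k = 1 \<or> l = n"
          using that n by (auto simp: pairs_def)
        then show ?thesis
          by (auto simp: F_def)
      qed
      then show "\<forall>kl\<in>pairs n - (SIGMA k:{2..n-2}. {k+1..n-1}). (case kl of (k, l) \<Rightarrow> F (k - 1) (n - l)) = 0"
        by (metis (no_types, lifting) DiffE case_prod_conv surj_pair)
    qed
    also have "\<dots> = (\<Sum>k=2..n-2. \<Sum>l=k+1..n-1. F (k - 1) (n - l))"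
      by (rule sum.Sigma[symmetric]) auto
    also have "\<dots> = (\<Sum>k=2..n-2. \<Sum>l=k+1..n-1. 1 - inverse (real ((n - l + k - 1) choose (k - 1))))"
      by (intro sum.cong refl) (auto simp: F_def add.commute)
    finally show ?thesis
      using s n by simp
  qed
  moreover have "(\<lambda>n. real (s_plus 4 p n) / fact n) \<longlonglongrightarrow> 1 / 2"
  proof (rule limit_of_bounded_columns)
    \<comment> \<open>For the limit the left and middle gaps are used: their sizes add up to
      \<open>l - 2\<close> independently of \<open>k\<close>, so a column runs through a full row of
      Pascal's triangle.\<close>
    show "(\<Sum>k=1..<l. inverse (real ((l - 2) choose (k - 1)))) \<le> 4" for l
    proof (cases "l \<ge> 2")
      case True
      then have "(\<Sum>k=1..<l. inverse (real ((l - 2) choose (k - 1)))) =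
          (\<Sum>j\<le>l-2. inverse (real ((l - 2) choose j)))"
        by (intro sum.reindex_bij_witness[where i = Suc and j = "\<lambda>k. k - 1"]) auto
      then show ?thesis
        using sum_inverse_binomial_le by simp
    qed simp
    show "real (s_plus 4 p n) =
        fact (n - 2) * (\<Sum>(k, l)\<in>pairs n. 1 - inverse (real ((l - 2) choose (k - 1))))" if "n \<ge> 1" for n
      unfolding s[OF that] by (intro arg_cong2[where f = "(*)"] sum.cong refl)
        (auto simp: pairs_def F_def numeral_2_eq_2)
  qed simp
  ultimately show ?thesis
    using False by blast
next
  case True
  have eq: "region_of (inv \<pi>) 2 = region_of (inv \<pi>) 3"
    using True adjacent_letters_iff_region_of_eq[OF assms(1)] by blast
  have s: "real (s_plus 4 p n) = fact (n - 2) * (\<Sum>(k, l)\<in>pairs n. 1 - 1 / fact (k - 1))"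
    if "n \<ge> 1" for n
    using s_plus_adjacent[OF assms(1) assms(3)[unfolded assms(2)] that eq]
      sum_pairs_gap[OF region_of_less_3, where F = "\<lambda>a. 1 - 1 / fact a" and n = n]
    by simp
  have "real (s_plus 4 p n) =
      fact (n - 2) * (\<Sum>k=3..n-1. real (n - k) * (1 - 1 / fact (k - 1)))" if n: "n \<ge> 4" for n
  proof -
    have "(\<Sum>(k, l)\<in>pairs n. 1 - 1 / fact (k - 1) :: real) = (\<Sum>k=1..n. \<Sum>l=k+1..n. 1 - 1 / fact (k - 1))"
      unfolding pairs_eq_Sigma by (rule sum.Sigma[symmetric]) auto
    also have "\<dots> = (\<Sum>k=1..n. real (n - k) * (1 - 1 / fact (k - 1)))"
      by simp
    \<comment> \<open>The terms for \<open>k = 1\<close> and \<open>k = 2\<close> vanish since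
      \<open>fact 0\<close> and \<open>fact 1\<close> are 1, the term for \<open>k = n\<close>
      because of the factor \<open>n - k\<close>.\<close>
    also have "\<dots> = (\<Sum>k=3..n-1. real (n - k) * (1 - 1 / fact (k - 1)))"
    proof (rule sum.mono_neutral_right)
      show "\<forall>k\<in>{1..n} - {3..n-1}. real (n - k) * (1 - 1 / fact (k - 1)) = (0 :: real)"
      proof
        fix k
        assume "k \<in> {1..n} - {3..n-1}"
        then have "k = 1 \<or> k = 2 \<or> k = n"
          by auto
        then show "real (n - k) * (1 - 1 / fact (k - 1)) = (0 :: real)"
          by auto
      qed
    qed auto
    finally show ?thesis
      using s n by simp
  qed
  moreover have "(\<lambda>n. real (s_plus 4 p n) / fact n) \<longlonglongrightarrow> 1 / 2"
  proof (rule limit_of_bounded_columns)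
    show "(\<Sum>k=1..<l. 1 / fact (k - 1) :: real) \<le> 4" for l
    proof -
      \<comment> \<open>Shifting the index by one turns the column into a partial sum of the
        exponential series at 1.\<close>
      have "(\<Sum>k=1..<l. 1 / fact (k - 1) :: real) = (\<Sum>j<l-1. 1 / fact j)"
        by (intro sum.reindex_bij_witness[where i = Suc and j = "\<lambda>k. k - 1"]) auto
      then show ?thesis
        using sum_inverse_fact_le by simp
    qed
  qed (use s in auto)
  ultimately show ?thesis
    using True by blast
qed

end
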